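(* Let $(X,d,\mu,\mathcal{E},\mathcal{F})$ be a strongly local metric Dirichlet space whose balls of finite radius have compact closure and whose heat semigroup $\{P_t\}_{t>0}$ has a continuous heat kernel $p_t(x,y)$ satisfying, for $\mu$-a.e. $x,y\in X$ and every $t>0$, $$\frac{c_1}{\mu(B(x,t^{1/d_W}))}\exp\Big(-c_2\Big(\frac{d(x,y)^{d_W}}{t}\Big)^{\frac1{d_W-1}}\Big)\le p_t(x,y)\le\frac{c_3}{\mu(B(x,t^{1/d_W}))}\exp\Big(-c_4\Big(\frac{d(x,y)^{d_W}}{t}\Big)^{\frac1{d_W-1}}\Big),$$ where $c_1,c_2,c_3,c_4>0$ and $d_W\ge2$. Let $R\in(0,+\infty]$ and assume that there exists a constant $C>0$ such that for every $t\in(0,R)$, $f\in L^\infty(X,\mu)$ and $x,y\in X$, $$|P_tf(x)-P_tf(y)|\le C\,\frac{d(x,y)^{d_W(1-\alpha_1)}}{t^{1-\alpha_1}}\,\|f\|_{L^\infty(X,\mu)}.$$ Then condition $(\mathrm{PPI}_1(R))$ is satisfied and the following equivalences of semi-norms are valid on $BV(\mathcal{E})$: $$\mathbf{Var}_{\mathcal{E}}(f)\simeq\liminf_{r\to0^+}\int_X\int_{B(x,r)}\frac{|f(y)-f(x)|}{r^{\alpha_1d_W}\mu(B(x,r))}\,d\mu(y)\,d\mu(x)$$ $$\simeq\sup_{r\in(0,R)}\int_X\int_{B(x,r)}\frac{|f(y)-f(x)|}{r^{\alpha_1d_W}\mu(B(x,r))}\,d\mu(y)\,d\mu(x)\sim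eq\|f\|_{1,\alpha_1,R}.$$
   Context: The heat semigroup $\{P_t\}$ of the Dirichlet form $(\mathcal{E},\mathcal{F})$ on $L^2(X,\mu)$ (extended to all $L^p(X,\mu)$) is assumed conservative: $P_t1=1$. $B(x,r)$ is the ball of $d$. For $\alpha\ge0$ (with $P_t(|f-f(y)|)(y)=\int_X|f(x)-f(y)|\,p_t(y,x)\,d\mu(x)$), $$\mathbf{B}^{1,\alpha}(X)=\Big\{f\in L^1(X,\mu):\limsup_{t\to0^+}t^{-\alpha}\int_XP_t(|f-f(y)|)(y)\,d\mu(y)<\infty\Big\},$$ $$\|f\|_{1,\alpha,R}=\sup_{t\in(0,R)}t^{-\alpha}\int_XP_t(|f-f(y)|)(y)\,d\mu(y).$$ Set $\alpha_1=\sup\{\alpha>0:\mathbf{B}^{1,\alpha}(X)\text{ contains non a.e. constant functions}\}$ (understood to be a finite positive number), $BV(\mathcal{E})=\mathbf{B}^{1,\alpha_1}(X)$, and for $f\in BV(\mathcal{E})$ $$\mathbf{Var}_{\mathcal{E}}(f)=\liminf_{t\to0^+}t^{-\alpha_1}\int_XP_t(|f-f(y)|)(y)\,d\mu(y).$$ Condition $(\mathrm{PPI}_1(R))$: there is $C_1(R)>0$ such that $\|P_tf-f\|_{L^1(X,\mu)}\le C_1(R)\,t^{\alpha_1}\mathbf{Var}_{\mathcal{E}}(f)$ for all $t\in(0,R)$ and $f\in BV(\mathcal{E})$. Notation: $\Lambda_1(f)\simeq\Lambda_2(f)$ means there are constants $c,C>0$, independent of $f$, with $c\Lambda_1(f)\le\Lambda_2(f)\le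 C\Lambda_1(f)$. *)

theory Defs
  imports "HOL-Probability.Probability"
begin

section \<open>Square integrable functions\<close>

text \<open>Elements of $L^p$ spaces are represented by measurable functions; equality in $L^p$ is
  equality almost everywhere.\<close>

definition L2 :: "'a measure \<Rightarrow> ('a \<Rightarrow> real) set" where
  "L2 M = {f. f \<in> borel_measurable M \<and> integrable M (\<lambda>x. (f x)\<^sup>2)}"

definition l2_inner :: "'a measure \<Rightarrow> ('a \<Rightarrow> real) \<Rightarrow> ('a \<Rightarrow> real) \<Rightarrow> real" where
  "l2_inner M f g = (\<integral>x. f x * g x \<partial>M)"

definition l2_norm :: "'a measure \<Rightarrow> ('a \<Rightarrow> real) \<Rightarrow> real" where
  "l2_norm M f = sqrt (l2_inner M f f)"


section \<open>Strongly local metric Dirichlet spaces\<close>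

definition radon_measure_full_support :: "('a::metric_space) measure \<Rightarrow> bool" where
  "radon_measure_full_support M \<longleftrightarrow>
     sets M = sets borel \<and>
     (\<forall>K. compact K \<longrightarrow> emeasure M K < \<infinity>) \<and>
     (\<forall>A\<in>sets M. emeasure M A = (SUP K\<in>{K. compact K \<and> K \<subseteq> A}. emeasure M K)) \<and>
     (\<forall>U. open U \<longrightarrow> U \<noteq> {} \<longrightarrow> emeasure M U > 0)"

definition E1_sq ::
  "'a measure \<Rightarrow> (('a \<Rightarrow> real) \<Rightarrow> ('a \<Rightarrow> real) \<Rightarrow> real) \<Rightarrow> ('a \<Rightarrow> real) \<Rightarrow> real" where
  "E1_sq M E u = E u u + l2_inner M u u"

text \<open>A densely defined, closed, symmetric, Markovian form on $L^2$. The second and the sixth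
  clause say that domain and form are well defined on classes of a.e. equal functions.\<close>

definition dirichlet_form ::
  "'a measure \<Rightarrow> (('a \<Rightarrow> real) \<Rightarrow> ('a \<Rightarrow> real) \<Rightarrow> real) \<Rightarrow> ('a \<Rightarrow> real) set \<Rightarrow> bool" where
  "dirichlet_form M E F \<longleftrightarrow>
     F \<subseteq> L2 M \<and>
     (\<forall>u\<in>F. \<forall>v\<in>borel_measurable M. (AE x in M. u x = v x) \<longrightarrow> v \<in> F) \<and>
     (\<lambda>x. 0) \<in> F \<and>
     (\<forall>u\<in>F. \<forall>v\<in>F. \<forall>a b. (\<lambda>x. a * u x + b * v x) \<in> F) \<and>
     (\<forall>f\<in>L2 M. \<forall>e>0. \<exists>u\<in>F. l2_norm M (\<lambda>x. f x - u x) < e) \<and>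
     (\<forall>u\<in>F. \<forall>v\<in>F. \<forall>w\<in>F. (AE x in M. u x = v x) \<longrightarrow> E u w = E v w) \<and>
     (\<forall>u\<in>F. \<forall>v\<in>F. \<forall>w\<in>F. \<forall>a b. E (\<lambda>x. a * u x + b * v x) w = a * E u w + b * E v w) \<and>
     (\<forall>u\<in>F. \<forall>v\<in>F. E u v = E v u) \<and>
     (\<forall>u\<in>F. E u u \<ge> 0) \<and>
     (\<forall>u :: nat \<Rightarrow> 'a \<Rightarrow> real.
        (\<forall>n. u n \<in> F) \<longrightarrow>
        (\<forall>e>0. \<exists>N. \<forall>m\<ge>N. \<forall>n\<ge>N. E1_sq M E (\<lambda>x. u m x - u n x) < e) \<longrightarrow>
        (\<exists>v\<in>F. (\<lambda>n. E1_sq M E (\<lambda>x. u n x - v x)) \<longlonglongrightarrow> 0)) \<and>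
     (\<forall>u\<in>F. (\<lambda>x. min (max (u x) 0) 1) \<in> F \<and>
            E (\<lambda>x. min (max (u x) 0) 1) (\<lambda>x. min (max (u x) 0) 1) \<le> E u u)"

definition Cc :: "('a::topological_space \<Rightarrow> real) set" where
  "Cc = {u. continuous_on UNIV u \<and> compact (closure {x. u x \<noteq> 0})}"

definition regular_form ::
  "('a::metric_space) measure \<Rightarrow> (('a \<Rightarrow> real) \<Rightarrow> ('a \<Rightarrow> real) \<Rightarrow> real) \<Rightarrow> ('a \<Rightarrow> real) set \<Rightarrow> bool"
  where
  "regular_form M E F \<longleftrightarrow>
     (\<forall>u\<in>F. \<forall>e>0. \<exists>v\<in>F \<inter> Cc. E1_sq M E (\<lambda>x. u x - v x) < e) \<and>
     (\<forall>u\<in>Cc. \<forall>e>0. \<exists>v\<in>F \<inter> Cc. \<forall>x. \<bar>u x - v x\<bar> < e)"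

text \<open>The support of an a.e. equivalence class, i.e. the support of the measure $|u|\,d\mu$.\<close>

definition ess_support :: "('a::topological_space) measure \<Rightarrow> ('a \<Rightarrow> real) \<Rightarrow> 'a set" where
  "ess_support M u = - \<Union>{U. open U \<and> (AE x in M. x \<in> U \<longrightarrow> u x = 0)}"

definition strongly_local_form ::
  "('a::metric_space) measure \<Rightarrow> (('a \<Rightarrow> real) \<Rightarrow> ('a \<Rightarrow> real) \<Rightarrow> real) \<Rightarrow> ('a \<Rightarrow> real) set \<Rightarrow> bool"
  where
  "strongly_local_form M E F \<longleftrightarrow>
     (\<forall>u\<in>F. \<forall>v\<in>F.
        compact (ess_support M u) \<longrightarrow> compact (ess_support M v) \<longrightarrow>
        (\<exists>U c. open U \<and> ess_support M u \<subseteq> U \<and> (AE x in M. x \<in> U \<longrightarrow> v x = c)) \<longrightarrow>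
        E u v = 0)"

text \<open>The space $X$ is the whole type, with its metric.\<close>

definition strongly_local_metric_dirichlet_space ::
  "('a::metric_space) measure \<Rightarrow> (('a \<Rightarrow> real) \<Rightarrow> ('a \<Rightarrow> real) \<Rightarrow> real) \<Rightarrow> ('a \<Rightarrow> real) set \<Rightarrow> bool"
  where
  "strongly_local_metric_dirichlet_space M E F \<longleftrightarrow>
     radon_measure_full_support M \<and> dirichlet_form M E F \<and>
     regular_form M E F \<and> strongly_local_form M E F"


section \<open>Heat semigroup and heat kernel\<close>

text \<open>The last clause identifies the infinitesimal generator of the semigroup (left) with the
  operator $L$ of the form, $\mathcal{E}(f,g) = -\langle Lf, g\rangle$ for all $g$ in the domain
  of the form (right).\<close>

definition heat_semigroup ::
  "'a measure \<Rightarrow> (('a \<Rightarrow> real) \<Rightarrow> ('a \<Rightarrow> real) \<Rightarrow> real) \<Rightarrow> ('a \<Rightarrow> real) set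
     \<Rightarrow> (real \<Rightarrow> ('a \<Rightarrow> real) \<Rightarrow> ('a \<Rightarrow> real)) \<Rightarrow> bool" where
  "heat_semigroup M E F P \<longleftrightarrow>
     (\<forall>t>0. \<forall>f\<in>L2 M. P t f \<in> L2 M) \<and>
     (\<forall>t>0. \<forall>f\<in>L2 M. \<forall>g\<in>L2 M. (AE x in M. f x = g x) \<longrightarrow> (AE x in M. P t f x = P t g x)) \<and>
     (\<forall>t>0. \<forall>f\<in>L2 M. \<forall>g\<in>L2 M. \<forall>a b.
        AE x in M. P t (\<lambda>z. a * f z + b * g z) x = a * P t f x + b * P t g x) \<and>
     (\<forall>s>0. \<forall>t>0. \<forall>f\<in>L2 M. AE x in M. P (s + t) f x = P s (P t f) x) \<and>
     (\<forall>t>0. \<forall>f\<in>L2 M. \<forall>g\<in>L2 M. l2_inner M (P t f) g = l2_inner M f (P t g)) \<and>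
     (\<forall>t>0. \<forall>f\<in>L2 M. l2_norm M (P t f) \<le> l2_norm M f) \<and>
     (\<forall>f\<in>L2 M. ((\<lambda>t. l2_norm M (\<lambda>x. P t f x - f x)) \<longlongrightarrow> 0) (at_right 0)) \<and>
     (\<forall>f\<in>L2 M. \<forall>h\<in>L2 M.
        ((\<lambda>t. l2_norm M (\<lambda>x. (P t f x - f x) / t - h x)) \<longlongrightarrow> 0) (at_right 0) \<longleftrightarrow>
        f \<in> F \<and> (\<forall>g\<in>F. E f g = - l2_inner M h g))"

definition continuous_heat_kernel ::
  "('a::metric_space) measure \<Rightarrow> (real \<Rightarrow> ('a \<Rightarrow> real) \<Rightarrow> ('a \<Rightarrow> real))
     \<Rightarrow> (real \<Rightarrow> 'a \<Rightarrow> 'a \<Rightarrow> real) \<Rightarrow> bool" where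
  "continuous_heat_kernel M P p \<longleftrightarrow>
     (\<forall>t>0. continuous_on UNIV (\<lambda>(x, y). p t x y)) \<and>
     (\<forall>t>0. \<forall>f\<in>L2 M. AE x in M.
        integrable M (\<lambda>y. p t x y * f y) \<and> P t f x = (\<integral>y. p t x y * f y \<partial>M))"

text \<open>The extension of the semigroup to all $L^p$ spaces, given by the kernel. On bounded
  functions it is the version of $P_t f$ that is defined at every point.\<close>

definition heat_op ::
  "'a measure \<Rightarrow> (real \<Rightarrow> 'a \<Rightarrow> 'a \<Rightarrow> real) \<Rightarrow> real \<Rightarrow> ('a \<Rightarrow> real) \<Rightarrow> 'a \<Rightarrow> real" where
  "heat_op M p t f x = (\<integral>y. p t x y * f y \<partial>M)"

definition conservative :: "'a measure \<Rightarrow> (real \<Rightarrow> 'a \<Rightarrow> 'a \<Rightarrow> real) \<Rightarrow> bool" where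
  "conservative M p \<longleftrightarrow> (\<forall>t>0. AE x in M. heat_op M p t (\<lambda>_. 1) x = 1)"

definition sub_gaussian_estimates ::
  "('a::metric_space) measure \<Rightarrow> (real \<Rightarrow> 'a \<Rightarrow> 'a \<Rightarrow> real)
     \<Rightarrow> real \<Rightarrow> real \<Rightarrow> real \<Rightarrow> real \<Rightarrow> real \<Rightarrow> bool" where
  "sub_gaussian_estimates M p dW c1 c2 c3 c4 \<longleftrightarrow>
     (AE x in M. AE y in M. \<forall>t>0.
        c1 / measure M (ball x (t powr (1 / dW)))
          * exp (- c2 * (dist x y powr dW / t) powr (1 / (dW - 1))) \<le> p t x y \<and>
        p t x y \<le> c3 / measure M (ball x (t powr (1 / dW)))
          * exp (- c4 * (dist x y powr dW / t) powr (1 / (dW - 1))))"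

definition Linfty :: "'a measure \<Rightarrow> ('a \<Rightarrow> real) set" where
  "Linfty M = {f. f \<in> borel_measurable M \<and> esssup M (\<lambda>x. ereal \<bar>f x\<bar>) < \<infinity>}"

definition linfty_norm :: "'a measure \<Rightarrow> ('a \<Rightarrow> real) \<Rightarrow> real" where
  "linfty_norm M f = real_of_ereal (esssup M (\<lambda>x. ereal \<bar>f x\<bar>))"


section \<open>Heat semigroup based Besov and BV spaces\<close>

text \<open>$\int_X P_t(|f-f(y)|)(y)\,d\mu(y)$. As this may be infinite, it is an extended nonnegative
  number, and so are the semi-norms below.\<close>

definition heat_variation ::
  "'a measure \<Rightarrow> (real \<Rightarrow> 'a \<Rightarrow> 'a \<Rightarrow> real) \<Rightarrow> real \<Rightarrow> ('a \<Rightarrow> real) \<Rightarrow> ennreal" where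
  "heat_variation M p t f =
     (\<integral>\<^sup>+ y. (\<integral>\<^sup>+ x. ennreal (\<bar>f x - f y\<bar> * p t y x) \<partial>M) \<partial>M)"

definition besov ::
  "'a measure \<Rightarrow> (real \<Rightarrow> 'a \<Rightarrow> 'a \<Rightarrow> real) \<Rightarrow> real \<Rightarrow> ('a \<Rightarrow> real) set" where
  "besov M p \<alpha> =
     {f. integrable M f \<and>
         Limsup (at_right 0) (\<lambda>t. ennreal (t powr (- \<alpha>)) * heat_variation M p t f) < \<infinity>}"

definition besov_seminorm ::
  "'a measure \<Rightarrow> (real \<Rightarrow> 'a \<Rightarrow> 'a \<Rightarrow> real) \<Rightarrow> real \<Rightarrow> ereal \<Rightarrow> ('a \<Rightarrow> real) \<Rightarrow> ennreal" where
  "besov_seminorm M p \<alpha> R f =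
     (SUP t\<in>{t. 0 < t \<and> ereal t < R}. ennreal (t powr (- \<alpha>)) * heat_variation M p t f)"

definition critical_exponent :: "'a measure \<Rightarrow> (real \<Rightarrow> 'a \<Rightarrow> 'a \<Rightarrow> real) \<Rightarrow> ereal" where
  "critical_exponent M p =
     (SUP \<alpha>\<in>{\<alpha>::real. \<alpha> > 0 \<and> (\<exists>f\<in>besov M p \<alpha>. \<not> (\<exists>c. AE x in M. f x = c))}. ereal \<alpha>)"

text \<open>In the following, \<open>\<alpha>1\<close> stands for the (finite, positive) critical exponent.\<close>

definition BV ::
  "'a measure \<Rightarrow> (real \<Rightarrow> 'a \<Rightarrow> 'a \<Rightarrow> real) \<Rightarrow> real \<Rightarrow> ('a \<Rightarrow> real) set" where
  "BV M p \<alpha>1 = besov M p \<alpha>1"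

definition heat_Var ::
  "'a measure \<Rightarrow> (real \<Rightarrow> 'a \<Rightarrow> 'a \<Rightarrow> real) \<Rightarrow> real \<Rightarrow> ('a \<Rightarrow> real) \<Rightarrow> ennreal" where
  "heat_Var M p \<alpha>1 f =
     Liminf (at_right 0) (\<lambda>t. ennreal (t powr (- \<alpha>1)) * heat_variation M p t f)"

definition PPI1 ::
  "'a measure \<Rightarrow> (real \<Rightarrow> 'a \<Rightarrow> 'a \<Rightarrow> real) \<Rightarrow> real \<Rightarrow> ereal \<Rightarrow> bool" where
  "PPI1 M p \<alpha>1 R \<longleftrightarrow>
     (\<exists>C1>0. \<forall>t f. 0 < t \<longrightarrow> ereal t < R \<longrightarrow> f \<in> BV M p \<alpha>1 \<longrightarrow>
        (\<integral>\<^sup>+ x. ennreal \<bar>heat_op M p t f x - f x\<bar> \<partial>M)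
          \<le> ennreal (C1 * t powr \<alpha>1) * heat_Var M p \<alpha>1 f)"

definition ball_variation ::
  "('a::metric_space) measure \<Rightarrow> real \<Rightarrow> real \<Rightarrow> real \<Rightarrow> ('a \<Rightarrow> real) \<Rightarrow> ennreal" where
  "ball_variation M dW \<alpha>1 r f =
     (\<integral>\<^sup>+ x. (\<integral>\<^sup>+ y\<in>ball x r.
        ennreal (\<bar>f y - f x\<bar> / (r powr (\<alpha>1 * dW) * measure M (ball x r))) \<partial>M) \<partial>M)"

definition seminorm_equiv ::
  "('a \<Rightarrow> real) set \<Rightarrow> (('a \<Rightarrow> real) \<Rightarrow> ennreal) \<Rightarrow> (('a \<Rightarrow> real) \<Rightarrow> ennreal) \<Rightarrow> bool" where
  "seminorm_equiv S \<Lambda>1 \<Lambda>2 \<longleftrightarrow>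
     (\<exists>c>0. \<exists>C>0. \<forall>f\<in>S. ennreal c * \<Lambda>1 f \<le> \<Lambda>2 f \<and> \<Lambda>2 f \<le> ennreal C * \<Lambda>1 f)"

end

theory Submission
  imports Defs
begin

text \<open>Write \<open>u\<close> for the indicator function of a set \<open>A\<close> of finite measure and
  \<open>\<phi>(t) = \<langle>P\<^sub>t u, u\<rangle>\<close>. By conservativeness and symmetry the
  heat variation of \<open>u\<close> at time \<open>t\<close> is twice the heat loss
  \<open>a(t) = \<phi>(0) - \<phi>(t)\<close>, and two properties of \<open>a\<close> are pure Hilbert
  space geometry: it is monotone because \<open>\<phi>(t)\<close> is the squared norm of
  \<open>P\<^sub>t\<^sub>/\<^sub>2 u\<close>, and \<open>a(2t) \<le> 2 a(t)\<close> because
  \<open>2 a(t) - a(2t)\<close> is the squared norm of \<open>u - P\<^sub>t u\<close>.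

  The Hoelder estimate enters through a telescoping sum. The increment
  \<open>\<phi>(s) - \<phi>(s + \<tau>)\<close> is the integral of
  \<open>p\<^sub>\<tau>(y,x) (P\<^sub>s u(y) - P\<^sub>s u(x))\<close> over \<open>y \<in> A\<close>,
  \<open>x \<notin> A\<close>, the part over \<open>A \<times> A\<close> being zero by symmetry. The
  Hoelder estimate bounds the difference by \<open>(\<tau>/s) powr (1 - \<alpha>)\<close> times a
  power of the scaled distance, and that power is absorbed by passing from
  \<open>p\<^sub>\<tau>\<close> to \<open>p\<^sub>m\<^sub>\<tau>\<close> with a fixed large
  \<open>m\<close>; this is where the two-sided kernel bounds are used. So the increment is at most a
  constant times \<open>(\<tau>/s) powr (1 - \<alpha>)\<close> times \<open>a(m\<tau>)\<close>.
  Summing over \<open>s = k\<tau>\<close>, \<open>k \<le> t/\<tau>\<close>, gives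
  \<open>a(t) \<le> K (t/\<tau>)\<^sup>\<alpha> a(m\<tau>)\<close> for all
  \<open>\<tau> \<le> t < R\<close> (\<open>heat_loss_le_smaller_time\<close>). The coarea formula,
  that is, integration over the level sets, transfers such inequalities from sets to all integrable
  functions (\<open>heat_variation_transfer\<close>).

  Hence the normalized heat variation at any time below \<open>R\<close> is bounded by its value at
  every smaller time, up to a constant. It is therefore bounded by the lower limit at zero, which is
  the variation. Since the heat variation dominates
  \<open>\<parallel>P\<^sub>t f - f\<parallel>\<close> in \<open>L\<^sup>1\<close>, the
  pseudo-Poincare inequality follows. Averages over balls compare with the heat variation at a single
  scale in both directions: the lower kernel bound gives
  \<open>ball_variation_le_heat_variation\<close>; conversely the part of the heat variation that
  comes from far pairs of points is at most half of the whole and can be absorbed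
  (\<open>heat_variation_le_ball_variation\<close>). With \<open>a(2t) \<le> 2 a(t)\<close> bridging
  the different ranges \<open>t < R\<close> and \<open>r < R\<close>, the four semi-norms bound each
  other cyclically.

  The exponents \<open>1 - \<alpha>\<close> above must be nonnegative. They are:
  \<open>a(2t) \<le> 2 a(t)\<close> makes every function in a Besov space of order larger than one
  constant almost everywhere (\<open>critical_exponent_le_1\<close>).\<close>

section \<open>Preliminary inequalities and limits\<close>

text \<open>Absorbs powers of the scaled distance into the exponential factor of the heat kernel.\<close>

lemma powr_mult_exp_bounded:
  fixes a b :: real
  assumes "0 < a" "0 \<le> b"
  obtains K where "0 < K" "\<And>x. 0 \<le> x \<Longrightarrow> x powr b * exp (- a * x) \<le> K"
proof (rule that[of "(b / a) powr b + 1"])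
  show "0 < (b / a) powr b + 1" by (simp add: add_nonneg_pos)
  fix x :: real assume x: "0 \<le> x"
  show "x powr b * exp (- a * x) \<le> (b / a) powr b + 1"
  proof (cases "b = 0")
    case True
    have "x powr 0 \<le> 1" "exp (- a * x) \<le> 1" using x assms by auto
    then have "x powr 0 * exp (- a * x) \<le> 1 * 1" by (intro mult_mono) auto
    then show ?thesis using True by auto
  next
    case False
    then have b: "0 < b" using assms by simp
    have "a * x / b \<le> exp (a * x / b)" using exp_ge_add_one_self[of "a * x / b"] by linarith
    then have "x \<le> b / a * exp (a * x / b)" using assms b by (simp add: field_simps)
    then have "x powr b \<le> (b / a * exp (a * x / b)) powr b" using x b by (intro powr_mono2) auto
    also have "\<dots> = (b / a) powr b * exp (a * x)"
      using b assms by (subst powr_mult) (auto simp: powr_def[of "exp _"])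
    finally have "x powr b * exp (- a * x) \<le> (b / a) powr b * exp (a * x) * exp (- a * x)"
      by (intro mult_right_mono) auto
    also have "\<dots> = (b / a) powr b" by (simp add: mult.assoc flip: exp_add)
    finally show ?thesis by simp
  qed
qed

text \<open>The weighted arithmetic-geometric mean inequality for \<open>x\<close> and \<open>x + 1\<close>.
  Summed over \<open>x = 0, 1, \<dots>\<close> it bounds the sum of the powers
  \<open>k\<^sup>a\<^sup>-\<^sup>1\<close>, \<open>1 \<le> k \<le> n\<close>, by
  \<open>n\<^sup>a / a\<close>.\<close>

lemma powr_increment_ge:
  fixes x a :: real
  assumes "0 \<le> x" "0 < a" "a \<le> 1"
  shows "a * (x + 1) powr (a - 1) \<le> (x + 1) powr a - x powr a"
proof (cases "x = 0")
  case False
  then have x: "0 < x" using assms by simp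
  have "x powr a * (x + 1) powr (1 - a) \<le> a * x + (1 - a) * (x + 1)"
    using assms x by (intro Youngs_inequality_0) auto
  then have "x powr a * (x + 1) powr (1 - a) * (x + 1) powr (a - 1)
      \<le> ((x + 1) - a) * (x + 1) powr (a - 1)"
    by (intro mult_right_mono) (auto simp: algebra_simps)
  moreover have "(x + 1) powr (1 - a) * (x + 1) powr (a - 1) = 1"
    using x by (simp flip: powr_add)
  moreover have "(x + 1) * (x + 1) powr (a - 1) = (x + 1) powr a"
    using x by (simp add: powr_diff)
  ultimately show ?thesis by (simp add: algebra_simps)
qed (use assms in auto)

lemma halving_below:
  fixes t \<delta> :: real
  assumes "0 < t" "0 < \<delta>"
  obtains N where "\<And>n. N \<le> n \<Longrightarrow> t / 2 ^ n < \<delta>"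
proof -
  have "(\<lambda>n. t * (1 / 2) ^ n) \<longlonglongrightarrow> t * 0"
    by (intro tendsto_intros LIMSEQ_power_zero) auto
  then have "\<forall>\<^sub>F n in sequentially. t * (1 / 2) ^ n < \<delta>"
    using assms by (intro order_tendstoD(2)) auto
  then show thesis using that by (auto simp: eventually_sequentially power_one_over)
qed

lemma abs_diff_eq_layers:
  fixes a b :: real
  shows "ennreal \<bar>a - b\<bar> = (\<integral>\<^sup>+s. ennreal \<bar>indicat_real {s<..} a - indicat_real {s<..} b\<bar> \<partial>lborel)"
proof -
  have "(\<integral>\<^sup>+s. ennreal \<bar>indicat_real {s<..} a - indicat_real {s<..} b\<bar> \<partial>lborel)
      = (\<integral>\<^sup>+s. indicator {min a b..<max a b} s \<partial>lborel)"
    by (intro nn_integral_cong) (auto simp: indicator_def)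
  also have "\<dots> = ennreal \<bar>a - b\<bar>"
    by (auto simp: min_def max_def intro!: arg_cong[where f=ennreal])
  finally show ?thesis ..
qed

text \<open>Turns a bound by all values of \<open>g\<close> near zero into one by the lower limit, however
  \<open>g\<close> oscillates.\<close>

lemma le_Liminf_at_right:
  fixes g :: "real \<Rightarrow> ennreal"
  assumes "0 < K" "0 < \<delta>" and le: "\<And>s. 0 < s \<Longrightarrow> s < \<delta> \<Longrightarrow> x \<le> ennreal K * g s"
  shows "x \<le> ennreal K * Liminf (at_right 0) g"
proof -
  have inv: "ennreal K * ennreal (1 / K) = 1"
    using assms by (simp add: ennreal_mult[symmetric])
  have "ennreal (1 / K) * x \<le> Liminf (at_right 0) g"
  proof (rule Liminf_bounded, unfold eventually_at_right_field, intro exI[of _ \<delta>] conjI allI impI)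
    fix s assume "0 < s" "s < \<delta>"
    then have "ennreal (1 / K) * x \<le> ennreal (1 / K) * (ennreal K * g s)"
      by (intro mult_left_mono le) auto
    also have "\<dots> = g s" using inv by (simp add: mult.assoc[symmetric] mult.commute)
    finally show "ennreal (1 / K) * x \<le> g s" .
  qed (rule assms)
  then have "ennreal K * (ennreal (1 / K) * x) \<le> ennreal K * Liminf (at_right 0) g"
    by (rule mult_left_mono) simp
  then show ?thesis using inv by (simp add: mult.assoc[symmetric])
qed

lemma Liminf_at_right_le_SUP:
  fixes g :: "real \<Rightarrow> ennreal" and R :: ereal
  assumes "0 < R"
  shows "Liminf (at_right 0) g \<le> (SUP t\<in>{t. 0 < t \<and> ereal t < R}. g t)"
proof (rule Liminf_le)
  obtain \<delta> where \<delta>: "0 < ereal \<delta>" "ereal \<delta> < R" using ereal_dense2[OF assms] by blast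
  then have "ereal t < R" if "t < \<delta>" for t using that by (meson ereal_less_eq(3) le_less_trans less_imp_le)
  then show "\<forall>\<^sub>F t in at_right 0. g t \<le> (SUP t\<in>{t. 0 < t \<and> ereal t < R}. g t)"
    using \<delta> unfolding eventually_at_right_field by (intro exI[of _ \<delta>]) (auto intro!: SUP_upper)
qed simp

lemma seminorm_equivI:
  assumes "0 < a" "0 < b"
    and 1: "\<And>f. f \<in> S \<Longrightarrow> \<Lambda>1 f \<le> ennreal a * \<Lambda>2 f"
    and 2: "\<And>f. f \<in> S \<Longrightarrow> \<Lambda>2 f \<le> ennreal b * \<Lambda>1 f"
  shows "seminorm_equiv S \<Lambda>1 \<Lambda>2"
  unfolding seminorm_equiv_def
proof -
  have "ennreal (1 / a) * \<Lambda>1 f \<le> \<Lambda>2 f" if "f \<in> S" for f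
  proof -
    have "ennreal (1 / a) * \<Lambda>1 f \<le> ennreal (1 / a) * (ennreal a * \<Lambda>2 f)"
      using that by (intro mult_left_mono 1) auto
    also have "\<dots> = \<Lambda>2 f"
      using assms by (simp add: mult.assoc[symmetric] ennreal_mult[symmetric])
    finally show ?thesis .
  qed
  moreover have "0 < 1 / a" using assms(1) by simp
  ultimately show "\<exists>c>0. \<exists>C>0. \<forall>f\<in>S. ennreal c * \<Lambda>1 f \<le> \<Lambda>2 f \<and> \<Lambda>2 f \<le> ennreal C * \<Lambda>1 f"
    using assms(2) 2 by blast
qed

section \<open>Joint measurability on spaces with precompact balls\<close>

text \<open>Each ball lies in a compact set, which has finite \<open>1/k\<close>-nets. The space is thus
  separable, although its type class does not say so.\<close>

lemma dense_sequence_of_precompact_balls: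
  assumes "\<And>(x::'a::metric_space) r. compact (closure (ball x r))"
  obtains D :: "nat \<Rightarrow> 'a::metric_space" where "\<And>y e. 0 < e \<Longrightarrow> \<exists>i. dist y (D i) < e"
proof -
  obtain x0 :: 'a where True by simp
  have "\<exists>G. finite G \<and> closure (ball x0 (real n)) \<subseteq> (\<Union>x\<in>G. ball x (1 / real (Suc k)))" for n k
    using compact_eq_totally_bounded[THEN iffD1, OF assms[of x0 "real n"]]
    by (meson divide_pos_pos of_nat_0_less_iff zero_less_Suc zero_less_one)
  then obtain G where G: "\<And>n k. finite (G n k)"
    "\<And>n k. closure (ball x0 (real n)) \<subseteq> (\<Union>x\<in>G n k. ball x (1 / real (Suc k)))"
    by metis
  define A where "A = (\<Union>n k. G n k)"
  have cA: "countable A"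
    unfolding A_def using G(1) by (intro countable_UN) (auto intro: countable_finite)
  have dA: "\<exists>d\<in>A. dist y d < e" if "0 < e" for y e
  proof -
    obtain n where n: "dist x0 y < real n" using reals_Archimedean2 by blast
    obtain k where k: "inverse (real (Suc k)) < e" using reals_Archimedean[OF \<open>0 < e\<close>] by blast
    have "y \<in> closure (ball x0 (real n))" using n closure_subset by (metis mem_ball subsetD)
    then obtain d where "d \<in> G n k" "dist d y < 1 / real (Suc k)" using G(2)[of n k] by fastforce
    moreover have "1 / real (Suc k) < e" using k by (simp add: inverse_eq_divide)
    ultimately have "d \<in> A" "dist y d < e" unfolding A_def by (auto simp: dist_commute)
    then show ?thesis by blast
  qed
  have neA: "A \<noteq> {}" using dA[of 1 x0] by auto
  show thesis
  proof (rule that[of "from_nat_into A"])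
    fix y and e :: real assume "0 < e"
    then obtain d where "d \<in> A" "dist y d < e" using dA by blast
    then show "\<exists>i. dist y (from_nat_into A i) < e"
      using from_nat_into_surj[OF cA] by metis
  qed
qed

text \<open>The Borel \<open>\<sigma>\<close>-algebra of the product is the product
  \<open>\<sigma>\<close>-algebra only by separability. Here it suffices to approximate the second
  argument by points of the dense sequence: \<open>g (x, D (q n y))\<close> is measurable since
  \<open>q n\<close> takes countably many values, and it converges to \<open>g (x, y)\<close>.\<close>

lemma borel_measurable_pair_of_continuous:
  fixes g :: "'a::metric_space \<times> 'a \<Rightarrow> real" and D :: "nat \<Rightarrow> 'a"
  assumes dense: "\<And>y e. 0 < e \<Longrightarrow> \<exists>i. dist y (D i) < e"
    and cont: "continuous_on UNIV g"
    and [measurable_cong]: "sets M = sets borel"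
  shows "g \<in> borel_measurable (M \<Otimes>\<^sub>M M)"
proof -
  define q where "q n y = (LEAST i. dist y (D i) < inverse (real (Suc n)))" for n y
  have q: "dist y (D (q n y)) < inverse (real (Suc n))" for n y
    unfolding q_def by (rule LeastI_ex) (simp add: dense del: of_nat_Suc)
  have gD[measurable]: "(\<lambda>x. g (x, D i)) \<in> borel_measurable M" for i
  proof -
    have "continuous_on UNIV (\<lambda>x. g (x, D i))"
      by (rule continuous_on_compose2[OF cont]) (auto intro!: continuous_intros)
    then show ?thesis
      using borel_measurable_continuous_onI measurable_cong_sets[OF assms(3) refl] by blast
  qed
  have dD[measurable]: "(\<lambda>x. dist x (D i)) \<in> borel_measurable M" for i
  proof -
    have "continuous_on UNIV (\<lambda>x. dist x (D i))" by (intro continuous_intros)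
    then show ?thesis
      using borel_measurable_continuous_onI measurable_cong_sets[OF assms(3) refl] by blast
  qed
  have [measurable]: "q n \<in> measurable M (count_space UNIV)" for n
    unfolding q_def by measurable
  show ?thesis
  proof (rule borel_measurable_LIMSEQ_real)
    show "(\<lambda>n. g (fst z, D (q n (snd z)))) \<longlonglongrightarrow> g z" for z
    proof -
      have "(\<lambda>n. dist (snd z) (D (q n (snd z)))) \<longlonglongrightarrow> 0"
        by (rule tendsto_sandwich[OF _ _ tendsto_const LIMSEQ_inverse_real_of_nat])
           (use q in \<open>auto intro!: always_eventually less_imp_le simp del: of_nat_Suc\<close>)
      then have "(\<lambda>n. D (q n (snd z))) \<longlonglongrightarrow> snd z"
        by (subst tendsto_dist_iff) (simp add: dist_commute)
      then have "(\<lambda>n. (fst z, D (q n (snd z)))) \<longlonglongrightarrow> (fst z, snd z)"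
        by (intro tendsto_intros)
      then have "(\<lambda>n. (fst z, D (q n (snd z)))) \<longlonglongrightarrow> z" by simp
      then show ?thesis
        using cont by (intro isCont_tendsto_compose[of z g]) (auto simp: continuous_on_eq_continuous_at simp del: split_paired_All)
    qed
    show "(\<lambda>z. g (fst z, D (q n (snd z)))) \<in> borel_measurable (M \<Otimes>\<^sub>M M)" for n
      by (rule measurable_compose_countable[where f="\<lambda>i z. g (fst z, D i)"]) measurable
  qed
qed

section \<open>Volume doubling and comparison of heat kernels\<close>

locale heat_kernel_space =
  fixes M :: "('a::metric_space) measure"
    and E :: "('a \<Rightarrow> real) \<Rightarrow> ('a \<Rightarrow> real) \<Rightarrow> real"
    and F :: "('a \<Rightarrow> real) set"
    and P :: "real \<Rightarrow> ('a \<Rightarrow> real) \<Rightarrow> ('a \<Rightarrow> real)"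
    and p :: "real \<Rightarrow> 'a \<Rightarrow> 'a \<Rightarrow> real"
    and c1 c2 c3 c4 dW :: real
  assumes dirichlet_space: "strongly_local_metric_dirichlet_space M E F"
    and precompact: "\<And>(x::'a) r. compact (closure (ball x r))"
    and semigroup: "heat_semigroup M E F P"
    and kernel: "continuous_heat_kernel M P p"
    and cons: "conservative M p"
    and pos: "c1 > 0" "c2 > 0" "c3 > 0" "c4 > 0" and dW: "dW \<ge> 2"
    and bounds: "sub_gaussian_estimates M p dW c1 c2 c3 c4"
begin

lemma sets_M: "sets M = sets borel"
  using dirichlet_space
  by (auto simp: strongly_local_metric_dirichlet_space_def radon_measure_full_support_def)

lemma space_M[simp]: "space M = UNIV"
  using sets_eq_imp_space_eq[OF sets_M] by simp

lemma ball_in_sets[measurable, simp]: "ball x r \<in> sets M"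
  by (simp add: sets_M)

lemma ball_finite: "emeasure M (ball x r) < \<infinity>"
proof -
  have "emeasure M (ball x r) \<le> emeasure M (closure (ball x r))"
    by (rule emeasure_mono[OF closure_subset]) (simp add: sets_M)
  also have "\<dots> < \<infinity>"
    using dirichlet_space precompact[of x r]
    unfolding strongly_local_metric_dirichlet_space_def radon_measure_full_support_def by blast
  finally show ?thesis .
qed

lemma measure_ball_pos: "0 < r \<Longrightarrow> 0 < measure M (ball x r)"
proof -
  assume "0 < r"
  then have "emeasure M (ball x r) > 0"
    using dirichlet_space open_ball[of x r] centre_in_ball[of x r]
    unfolding strongly_local_metric_dirichlet_space_def radon_measure_full_support_def by blast
  then show ?thesis
    using ball_finite[of x r] by (simp add: measure_def enn2real_positive_iff)
qed

lemma sigma_finite_M: "sigma_finite_measure M"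
proof
  obtain x0 :: 'a where True by simp
  show "\<exists>A. countable A \<and> A \<subseteq> sets M \<and> \<Union>A = space M \<and> (\<forall>a\<in>A. emeasure M a \<noteq> \<infinity>)"
  proof (intro exI conjI)
    show "\<Union> (range (\<lambda>n. ball x0 (real n))) = space M"
      using reals_Archimedean2 by auto
  qed (use ball_finite in \<open>auto simp: less_top[symmetric]\<close>)
qed

sublocale sigma_finite_measure M by (rule sigma_finite_M)
sublocale pair: pair_sigma_finite M M ..

lemma continuous_pair_measurable:
  assumes "continuous_on UNIV (g :: 'a \<times> 'a \<Rightarrow> real)"
  shows "g \<in> borel_measurable (M \<Otimes>\<^sub>M M)"
  using dense_sequence_of_precompact_balls[OF precompact]
    borel_measurable_pair_of_continuous[OF _ assms sets_M] by metis

lemma kernel_measurable: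
  assumes "0 < t"
  shows "(\<lambda>z. p t (fst z) (snd z)) \<in> borel_measurable (M \<Otimes>\<^sub>M M)"
  using continuous_pair_measurable[of "\<lambda>(x, y). p t x y"] kernel assms
  by (auto simp: continuous_heat_kernel_def case_prod_beta)

lemma kernel_measurable_comp[measurable (raw)]:
  assumes "0 < t" "f \<in> measurable N M" "g \<in> measurable N M"
  shows "(\<lambda>x. p t (f x) (g x)) \<in> borel_measurable N"
  using measurable_compose[OF measurable_Pair[OF assms(2,3)] kernel_measurable[OF assms(1)]] by simp

lemma dist_measurable[measurable (raw)]:
  assumes "f \<in> measurable N M" "g \<in> measurable N M"
  shows "(\<lambda>x. dist (f x) (g x)) \<in> borel_measurable N"
proof -
  have "(\<lambda>z. dist (fst z) (snd z)) \<in> borel_measurable (M \<Otimes>\<^sub>M M)"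
    by (rule continuous_pair_measurable) (intro continuous_intros)
  from measurable_compose[OF measurable_Pair[OF assms] this] show ?thesis by simp
qed

lemma ball_measure_measurable[measurable]: "(\<lambda>x. measure M (ball x r)) \<in> borel_measurable M"
proof -
  have "(\<lambda>x. \<integral>\<^sup>+y. indicator {y. dist x y < r} y \<partial>M) \<in> borel_measurable M"
    by measurable
  also have "(\<lambda>x. \<integral>\<^sup>+y. indicator {y. dist x y < r} y \<partial>M) = (\<lambda>x. emeasure M (ball x r))"
  proof
    fix x :: 'a
    have "{y. dist x y < r} = ball x r" by auto
    then show "(\<integral>\<^sup>+y. indicator {y. dist x y < r} y \<partial>M) = emeasure M (ball x r)" by simp
  qed
  finally show ?thesis unfolding measure_def by measurable
qed

lemma kernel_bounds:
  "AE y in M. AE x in M. \<forall>t>0.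
     c1 / measure M (ball y (t powr (1 / dW)))
       * exp (- c2 * (dist y x powr dW / t) powr (1 / (dW - 1))) \<le> p t y x \<and>
     p t y x \<le> c3 / measure M (ball y (t powr (1 / dW)))
       * exp (- c4 * (dist y x powr dW / t) powr (1 / (dW - 1)))"
  using bounds unfolding sub_gaussian_estimates_def .

lemma kernel_pos: "AE y in M. AE x in M. \<forall>t>0. 0 < p t y x"
  using kernel_bounds
proof eventually_elim
  case (elim y)
  then show ?case
  proof eventually_elim
    case (elim x)
    show ?case
    proof (intro allI impI)
      fix t :: real assume t: "0 < t"
      have "0 < c1 / measure M (ball y (t powr (1 / dW)))
         * exp (- c2 * (dist y x powr dW / t) powr (1 / (dW - 1)))"
        using pos t by (intro mult_pos_pos divide_pos_pos measure_ball_pos) auto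
      with elim t show "0 < p t y x" by fastforce
    qed
  qed
qed

lemma kernel_mass:
  assumes "0 < t"
  shows "AE y in M. integrable M (p t y) \<and> (\<integral>x. p t y x \<partial>M) = 1"
proof -
  have "AE y in M. heat_op M p t (\<lambda>_. 1) y = 1"
    using cons assms by (auto simp: conservative_def)
  then show ?thesis
  proof eventually_elim
    case (elim y)
    then have "(\<integral>x. p t y x \<partial>M) = 1" by (simp add: heat_op_def)
    then show ?case using not_integrable_integral_eq by fastforce
  qed
qed

text \<open>The lower kernel bound, integrated over the larger ball, is at most the total mass one.\<close>

lemma doubling:
  assumes "0 < t" "0 \<le> l"
  shows "AE y in M. measure M (ball y (l * t powr (1 / dW)))
     \<le> exp (c2 * l powr (dW / (dW - 1))) / c1 * measure M (ball y (t powr (1 / dW)))"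
  using kernel_mass[OF assms(1)] kernel_bounds kernel_pos
proof eventually_elim
  case (elim y)
  let ?r = "t powr (1 / dW)"
  let ?k = "c1 / measure M (ball y ?r) * exp (- c2 * l powr (dW / (dW - 1)))"
  have m: "0 < measure M (ball y ?r)" using assms by (intro measure_ball_pos) simp
  have le: "AE x in M. ?k * indicator (ball y (l * ?r)) x \<le> p t y x"
    using elim(2) elim(3)
  proof eventually_elim
    case (elim x)
    show ?case
    proof (cases "x \<in> ball y (l * ?r)")
      case True
      then have "dist y x powr dW / t \<le> (l * ?r) powr dW / t"
        using dW assms by (intro divide_right_mono powr_mono2) auto
      also have "\<dots> = l powr dW"
        using assms dW by (simp add: powr_mult powr_powr)
      finally have "(dist y x powr dW / t) powr (1 / (dW - 1)) \<le> (l powr dW) powr (1 / (dW - 1))"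
        using dW assms by (intro powr_mono2) auto
      also have "\<dots> = l powr (dW / (dW - 1))" by (simp add: powr_powr)
      finally have "?k \<le> c1 / measure M (ball y ?r)
          * exp (- c2 * (dist y x powr dW / t) powr (1 / (dW - 1)))"
        using pos m by (intro mult_left_mono) auto
      then show ?thesis using elim assms True by fastforce
    qed (use elim assms in \<open>auto intro: less_imp_le\<close>)
  qed
  have "?k * measure M (ball y (l * ?r)) = (\<integral>x. ?k * indicator (ball y (l * ?r)) x \<partial>M)"
    by simp
  also have "\<dots> \<le> (\<integral>x. p t y x \<partial>M)"
    using elim(1) le ball_finite[of y "l * ?r"]
    by (intro integral_mono_AE) (auto intro!: integrable_mult_right integrable_real_indicator)
  finally have "?k * measure M (ball y (l * ?r)) \<le> 1" using elim(1) by simp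
  then show ?case
    using m pos(1) by (simp add: field_simps exp_minus)
qed


text \<open>The argument of the exponential in the kernel bounds, without its constant.\<close>

definition scaled_dist :: "real \<Rightarrow> 'a \<Rightarrow> 'a \<Rightarrow> real" where
  "scaled_dist t y x = (dist y x powr dW / t) powr (1 / (dW - 1))"

text \<open>Enlarging the time by a factor \<open>2\<^sup>j\<close> weakens the Gaussian decay of the lower
  bound. Once \<open>j\<close> is so large that it decays at most half as fast as the upper bound,
  half of the decay of the upper bound is left over; doubling compares the two normalizing volumes.
  The factor is a power of two so that it can be undone by \<open>heat_variation_power2\<close>.\<close>

lemma kernel_comparison:
  obtains j :: nat and A :: real where "0 < A"
    "\<And>t. 0 < t \<Longrightarrow>
       AE y in M. AE x in M. p t y x \<le> A * exp (- (c4 / 2) * scaled_dist t y x) * p (2 ^ j * t) y x"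
proof -
  obtain j :: nat where j: "(2 * c2 / c4) powr (dW - 1) < 2 ^ j"
    using real_arch_pow[of 2] by auto
  define m :: real where "m = 2 ^ j"
  define q where "q = 1 / (dW - 1)"
  have q: "0 < q" "(dW - 1) * q = 1" using dW by (auto simp: q_def)
  have m: "0 < m" by (simp add: m_def)
  have "2 * c2 / c4 = ((2 * c2 / c4) powr (dW - 1)) powr q"
    using pos q by (simp add: powr_powr)
  also have "\<dots> \<le> m powr q" using j q by (intro powr_mono2) (auto simp: m_def)
  finally have mq: "c2 / m powr q \<le> c4 / 2" using pos m by (simp add: field_simps)
  \<comment> \<open>The constant of \<open>doubling\<close> for the radii belonging to the times \<open>t\<close> and \<open>m t\<close>.\<close>
  define D where "D = exp (c2 * (m powr (1 / dW)) powr (dW / (dW - 1))) / c1"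
  have D: "0 < D" using pos by (simp add: D_def)
  show thesis
  proof (rule that[of "c3 / c1 * D" j])
    show "0 < c3 / c1 * D" using pos D by simp
    fix t :: real assume t: "0 < t"
    show "AE y in M. AE x in M.
        p t y x \<le> c3 / c1 * D * exp (- (c4 / 2) * scaled_dist t y x) * p (2 ^ j * t) y x"
      using kernel_bounds doubling[OF t powr_ge_zero[of m "1 / dW"]]
    proof eventually_elim
      case (elim y)
      let ?V = "measure M (ball y (t powr (1 / dW)))"
      let ?W = "measure M (ball y ((m * t) powr (1 / dW)))"
      have V: "0 < ?V" "0 < ?W" using t m by (auto intro!: measure_ball_pos)
      have W: "?W \<le> D * ?V"
        using elim(2) t m by (simp add: D_def powr_mult)
      show ?case using elim(1)
      proof eventually_elim
        case (elim x)
        let ?s = "scaled_dist t y x"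
        have s: "0 \<le> ?s" by (simp add: scaled_dist_def)
        have sm: "(dist y x powr dW / (m * t)) powr (1 / (dW - 1)) = ?s / m powr q"
          using t m by (simp add: scaled_dist_def q_def powr_divide powr_mult)
        \<comment> \<open>Half of the upper decay \<open>c4\<close> still dominates the decay of the lower bound at time \<open>m t\<close>.\<close>
        have "c1 / (D * ?V) * exp (- (c4 / 2) * ?s) \<le> c1 / ?W * exp (- c2 * (?s / m powr q))"
        proof (rule mult_mono)
          show "c1 / (D * ?V) \<le> c1 / ?W" using W V pos D by (intro divide_left_mono) auto
          have "c2 / m powr q * ?s \<le> c4 / 2 * ?s" using mq s by (rule mult_right_mono)
          then show "exp (- (c4 / 2) * ?s) \<le> exp (- c2 * (?s / m powr q))" by simp
        qed (use pos V in auto)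
        also have "\<dots> \<le> p (m * t) y x"
          using elim[rule_format, of "m * t"] t m sm by simp
        finally have low: "c1 / (D * ?V) * exp (- (c4 / 2) * ?s) \<le> p (m * t) y x" .
        have "p t y x \<le> c3 / ?V * exp (- c4 * ?s)"
          using elim t by (simp add: scaled_dist_def)
        also have "exp (- c4 * ?s) = exp (- (c4 / 2) * ?s) * exp (- (c4 / 2) * ?s)"
          by (simp flip: exp_add)
        also have "c3 / ?V * (exp (- (c4 / 2) * ?s) * exp (- (c4 / 2) * ?s))
            = c3 / c1 * D * exp (- (c4 / 2) * ?s) * (c1 / (D * ?V) * exp (- (c4 / 2) * ?s))"
          using D pos V by (simp add: field_simps)
        also have "\<dots> \<le> c3 / c1 * D * exp (- (c4 / 2) * ?s) * p (m * t) y x"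
          using low D pos by (intro mult_left_mono) auto
        finally show ?case by (simp add: m_def)
      qed
    qed
  qed
qed

section \<open>Heat loss of a set of finite measure\<close>

lemma indicator_L2:
  assumes "A \<in> sets M" "emeasure M A < \<infinity>"
  shows "indicat_real A \<in> L2 M"
proof -
  have "(\<lambda>x. (indicat_real A x)\<^sup>2) = indicat_real A" by (auto simp: indicator_def)
  with assms show ?thesis by (auto simp: L2_def intro!: integrable_real_indicator)
qed

lemma L2_measurable[measurable_dest]: "f \<in> L2 M \<Longrightarrow> f \<in> borel_measurable M"
  by (simp add: L2_def)

lemma L2_mult_integrable:
  assumes "f \<in> L2 M" "g \<in> L2 M"
  shows "integrable M (\<lambda>x. f x * g x)"
proof (rule Bochner_Integration.integrable_bound)
  show "integrable M (\<lambda>x. (f x)\<^sup>2 + (g x)\<^sup>2)" using assms by (auto simp: L2_def)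
  show "(\<lambda>x. f x * g x) \<in> borel_measurable M" using assms by (auto simp: L2_def)
  have "\<bar>a * b\<bar> \<le> a\<^sup>2 + b\<^sup>2" for a b :: real
  proof -
    have "2 * \<bar>a * b\<bar> \<le> a\<^sup>2 + b\<^sup>2"
      using sum_squares_bound[of "\<bar>a\<bar>" "\<bar>b\<bar>"] by (simp add: abs_mult)
    then show ?thesis using abs_ge_zero[of "a * b"] by linarith
  qed
  then show "AE x in M. norm (f x * g x) \<le> norm ((f x)\<^sup>2 + (g x)\<^sup>2)" by simp
qed

lemma L2_mult_indicator:
  assumes "f \<in> L2 M" "A \<in> sets M"
  shows "(\<lambda>x. indicator A x * f x) \<in> L2 M"
proof -
  have "(\<lambda>x. (indicator A x * f x)\<^sup>2) = (\<lambda>x. indicator A x * (f x)\<^sup>2)"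
    by (auto simp: indicator_def)
  with assms show ?thesis
    using integrable_real_mult_indicator[of A M "\<lambda>x. (f x)\<^sup>2"] by (auto simp: L2_def mult.commute)
qed

lemma P_L2: "0 < t \<Longrightarrow> f \<in> L2 M \<Longrightarrow> P t f \<in> L2 M"
  using semigroup by (auto simp: heat_semigroup_def)

lemma P_self_adjoint:
  "0 < t \<Longrightarrow> f \<in> L2 M \<Longrightarrow> g \<in> L2 M \<Longrightarrow> l2_inner M (P t f) g = l2_inner M f (P t g)"
  using semigroup by (auto simp: heat_semigroup_def)

lemma P_add:
  assumes "0 < t" "f \<in> L2 M" "g \<in> L2 M"
  shows "AE x in M. P t (\<lambda>z. f z + g z) x = P t f x + P t g x"
proof -
  have "\<forall>f\<in>L2 M. \<forall>g\<in>L2 M. \<forall>a b.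
      AE x in M. P t (\<lambda>z. a * f z + b * g z) x = a * P t f x + b * P t g x"
    using semigroup assms(1) by (simp add: heat_semigroup_def)
  from this[rule_format, OF assms(2,3), of 1 1] show ?thesis by simp
qed

lemma P_semigroup:
  "0 < s \<Longrightarrow> 0 < t \<Longrightarrow> f \<in> L2 M \<Longrightarrow> AE x in M. P (s + t) f x = P s (P t f) x"
  using semigroup by (auto simp: heat_semigroup_def)

lemma P_contraction: "0 < t \<Longrightarrow> f \<in> L2 M \<Longrightarrow> l2_norm M (P t f) \<le> l2_norm M f"
  using semigroup by (auto simp: heat_semigroup_def)

lemma P_kernel:
  "0 < t \<Longrightarrow> f \<in> L2 M \<Longrightarrow>
     AE y in M. integrable M (\<lambda>x. p t y x * f x) \<and> P t f y = (\<integral>x. p t y x * f x \<partial>M)"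
  using kernel by (auto simp: continuous_heat_kernel_def)

lemma l2_inner_cong:
  assumes "AE x in M. f x = f' x" "f \<in> L2 M" "f' \<in> L2 M" "g \<in> L2 M"
  shows "l2_inner M f g = l2_inner M f' g"
proof -
  have [measurable]: "f \<in> borel_measurable M" "f' \<in> borel_measurable M" "g \<in> borel_measurable M"
    using assms by (auto dest: L2_measurable)
  show ?thesis
    unfolding l2_inner_def using assms(1) by (intro integral_cong_AE) auto
qed

definition heat_flow :: "real \<Rightarrow> 'a set \<Rightarrow> 'a set \<Rightarrow> ennreal" where
  "heat_flow t A B = (\<integral>\<^sup>+y\<in>A. (\<integral>\<^sup>+x\<in>B. ennreal (p t y x) \<partial>M) \<partial>M)"

text \<open>The heat that has left \<open>A\<close> by time \<open>t\<close> if the initial temperature is one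
  on \<open>A\<close> and zero elsewhere.\<close>

definition heat_loss :: "real \<Rightarrow> 'a set \<Rightarrow> real" where
  "heat_loss t A = measure M A - l2_inner M (P t (indicat_real A)) (indicat_real A)"

lemma P_indicator_eq_nn_integral:
  assumes "0 < t" "A \<in> sets M" "emeasure M A < \<infinity>"
  shows "AE y in M. 0 \<le> P t (indicat_real A) y \<and>
     ennreal (P t (indicat_real A) y) = (\<integral>\<^sup>+x\<in>A. ennreal (p t y x) \<partial>M)"
  using P_kernel[OF assms(1) indicator_L2[OF assms(2,3)]] kernel_pos
proof eventually_elim
  case (elim y)
  have nn: "AE x in M. 0 \<le> p t y x * indicat_real A x"
    using elim(2) by eventually_elim (use assms in \<open>auto simp: indicator_def intro: less_imp_le\<close>)
  have "ennreal (P t (indicat_real A) y) = (\<integral>\<^sup>+x. ennreal (p t y x * indicat_real A x) \<partial>M)"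
    using elim(1) nn by (simp add: nn_integral_eq_integral)
  also have "\<dots> = (\<integral>\<^sup>+x\<in>A. ennreal (p t y x) \<partial>M)"
    by (intro nn_integral_cong) (auto simp: indicator_def)
  finally show ?case using elim(1) nn integral_nonneg_AE[OF nn] by simp
qed

lemma heat_flow_eq_l2_inner:
  assumes "0 < t" "A \<in> sets M" "emeasure M A < \<infinity>" "B \<in> sets M" "emeasure M B < \<infinity>"
  shows "heat_flow t B A = ennreal (l2_inner M (P t (indicat_real A)) (indicat_real B))"
proof -
  note A = indicator_L2[OF assms(2,3)] and B = indicator_L2[OF assms(4,5)]
  have "ennreal (l2_inner M (P t (indicat_real A)) (indicat_real B))
      = (\<integral>\<^sup>+y. ennreal (P t (indicat_real A) y * indicat_real B y) \<partial>M)"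
    unfolding l2_inner_def
    using P_indicator_eq_nn_integral[OF assms(1-3)]
    by (intro nn_integral_eq_integral[symmetric] L2_mult_integrable P_L2 A B assms)
       (auto elim!: AE_mp)
  also have "\<dots> = heat_flow t B A"
    unfolding heat_flow_def using P_indicator_eq_nn_integral[OF assms(1-3)]
    by (intro nn_integral_cong_AE) (auto elim!: AE_mp simp: indicator_def)
  finally show ?thesis ..
qed

text \<open>Symmetry of the semigroup on \<open>L\<^sup>2\<close> is symmetry of the kernel in integrated form.\<close>

lemma heat_flow_symmetric:
  assumes "0 < t" "A \<in> sets M" "emeasure M A < \<infinity>" "B \<in> sets M" "emeasure M B < \<infinity>"
  shows "heat_flow t B A = heat_flow t A B"
proof -
  have "l2_inner M (P t (indicat_real A)) (indicat_real B)
      = l2_inner M (indicat_real A) (P t (indicat_real B))"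
    using assms by (intro P_self_adjoint indicator_L2)
  also have "\<dots> = l2_inner M (P t (indicat_real B)) (indicat_real A)"
    by (simp add: l2_inner_def mult.commute)
  finally show ?thesis using assms by (simp add: heat_flow_eq_l2_inner)
qed

text \<open>The complement may have infinite measure, so that its indicator need not be in
  \<open>L\<^sup>2\<close>. It is exhausted by sets of finite measure.\<close>

lemma heat_flow_symmetric_compl:
  assumes [measurable]: "A \<in> sets M" and t: "0 < t" and fin: "emeasure M A < \<infinity>"
  shows "heat_flow t (- A) A = heat_flow t A (- A)"
proof -
  obtain x0 :: 'a where True by simp
  define B where "B n = - A \<inter> ball x0 (real n)" for n :: nat
  have [measurable]: "- A \<in> sets M" using assms(1) by (simp add: sets_M)
  have B[measurable]: "B n \<in> sets M" for n by (simp add: B_def)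
  have Bfin: "emeasure M (B n) < \<infinity>" for n
    using ball_finite[of x0 "real n"] emeasure_mono[of "B n" "ball x0 (real n)" M]
    by (auto simp: B_def intro: le_less_trans)
  have incB: "incseq B" by (rule incseq_SucI) (auto simp: B_def)
  have UB: "(\<Union>n. B n) = - A" using reals_Archimedean2 by (auto simp: B_def)
  have ind: "(SUP n. indicator (B n) x) = (indicator (- A) x :: ennreal)" for x
  proof (rule LIMSEQ_unique[OF LIMSEQ_SUP])
    show "incseq (\<lambda>n. indicator (B n) x :: ennreal)"
      using incB by (auto simp: incseq_def indicator_def)
    show "(\<lambda>n. indicator (B n) x :: ennreal) \<longlonglongrightarrow> indicator (- A) x"
      using LIMSEQ_indicator_incseq[OF incB, of x] by (simp add: UB)
  qed
  have incind: "incseq (\<lambda>n. c * indicator (B n) x :: ennreal)" for c x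
    using incB by (auto simp: incseq_def indicator_def)
  have m1: "(\<lambda>y. \<integral>\<^sup>+x\<in>A. ennreal (p t y x) \<partial>M) \<in> borel_measurable M"
    using t by measurable
  have "heat_flow t (- A) A = (\<integral>\<^sup>+y. (SUP n. (\<integral>\<^sup>+x\<in>A. ennreal (p t y x) \<partial>M) * indicator (B n) y) \<partial>M)"
    unfolding heat_flow_def by (simp add: SUP_mult_left_ennreal[symmetric] ind)
  also have "\<dots> = (SUP n. heat_flow t (B n) A)"
    unfolding heat_flow_def
    by (rule nn_integral_monotone_convergence_SUP)
      (use incind m1 in \<open>auto simp: incseq_def le_fun_def\<close>)
  also have "\<dots> = (SUP n. heat_flow t A (B n))"
    using heat_flow_symmetric[OF t assms(1) fin B Bfin] by simp
  also have "\<dots> = (\<integral>\<^sup>+y. (SUP n. (\<integral>\<^sup>+x\<in>B n. ennreal (p t y x) \<partial>M) * indicator A y) \<partial>M)"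
    unfolding heat_flow_def
    by (rule nn_integral_monotone_convergence_SUP[symmetric])
      (use incind t in \<open>auto simp: incseq_def le_fun_def intro!: mult_right_mono nn_integral_mono\<close>)
  also have "\<dots> = (\<integral>\<^sup>+y\<in>A. (SUP n. \<integral>\<^sup>+x\<in>B n. ennreal (p t y x) \<partial>M) \<partial>M)"
    by (simp add: SUP_mult_right_ennreal)
  also have "\<dots> = (\<integral>\<^sup>+y\<in>A. (\<integral>\<^sup>+x. (SUP n. ennreal (p t y x) * indicator (B n) x) \<partial>M) \<partial>M)"
    by (intro nn_integral_cong arg_cong2[where f="(*)"]
        nn_integral_monotone_convergence_SUP[symmetric] refl)
      (use incind t in \<open>auto simp: incseq_def le_fun_def\<close>)
  also have "\<dots> = heat_flow t A (- A)"
    unfolding heat_flow_def by (simp add: SUP_mult_left_ennreal[symmetric] ind)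
  finally show ?thesis .
qed

text \<open>By conservativeness, \<open>1 - P\<^sub>t u\<close> is the heat operator applied to the indicator of
  the complement.\<close>

lemma one_minus_P_indicator:
  assumes "0 < t" "A \<in> sets M" "emeasure M A < \<infinity>"
  shows "AE y in M. integrable M (\<lambda>x. p t y x * indicat_real (- A) x) \<and>
     1 - P t (indicat_real A) y = (\<integral>x. p t y x * indicat_real (- A) x \<partial>M)"
  using kernel_mass[OF assms(1)] P_kernel[OF assms(1) indicator_L2[OF assms(2,3)]]
proof eventually_elim
  case (elim y)
  have eq: "(\<lambda>x. p t y x * indicat_real (- A) x) = (\<lambda>x. p t y x - p t y x * indicat_real A x)"
    by (auto simp: indicator_def)
  show ?case unfolding eq using elim by simp
qed

lemma heat_loss_integral:
  assumes "0 < t" "A \<in> sets M" "emeasure M A < \<infinity>"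
  shows "integrable M (\<lambda>y. (1 - P t (indicat_real A) y) * indicat_real A y)"
    and "heat_loss t A = (\<integral>y. (1 - P t (indicat_real A) y) * indicat_real A y \<partial>M)"
proof -
  have i: "integrable M (indicat_real A)" using assms by (intro integrable_real_indicator)
  have j: "integrable M (\<lambda>y. P t (indicat_real A) y * indicat_real A y)"
    by (intro L2_mult_integrable P_L2 indicator_L2 assms)
  have eq: "(\<lambda>y. (1 - P t (indicat_real A) y) * indicat_real A y)
      = (\<lambda>y. indicat_real A y - P t (indicat_real A) y * indicat_real A y)"
    by (auto simp: algebra_simps)
  show "integrable M (\<lambda>y. (1 - P t (indicat_real A) y) * indicat_real A y)"
    unfolding eq using i j by (rule Bochner_Integration.integrable_diff)
  show "heat_loss t A = (\<integral>y. (1 - P t (indicat_real A) y) * indicat_real A y \<partial>M)"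
    unfolding eq heat_loss_def l2_inner_def using i j by simp
qed

lemma heat_loss_eq_flow:
  assumes "0 < t" "A \<in> sets M" "emeasure M A < \<infinity>"
  shows "0 \<le> heat_loss t A" "ennreal (heat_loss t A) = heat_flow t A (- A)"
proof -
  have nn: "AE y in M. 0 \<le> 1 - P t (indicat_real A) y \<and>
      ennreal (1 - P t (indicat_real A) y) = (\<integral>\<^sup>+x\<in>- A. ennreal (p t y x) \<partial>M)"
    using one_minus_P_indicator[OF assms] kernel_pos
  proof eventually_elim
    case (elim y)
    have nn: "AE x in M. 0 \<le> p t y x * indicat_real (- A) x"
      using elim(2) by eventually_elim (use assms in \<open>auto simp: indicator_def intro: less_imp_le\<close>)
    have "ennreal (1 - P t (indicat_real A) y) = (\<integral>\<^sup>+x. ennreal (p t y x * indicat_real (- A) x) \<partial>M)"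
      using elim(1) nn by (simp add: nn_integral_eq_integral)
    also have "\<dots> = (\<integral>\<^sup>+x\<in>- A. ennreal (p t y x) \<partial>M)"
      by (intro nn_integral_cong) (auto simp: indicator_def)
    finally show ?case using elim(1) integral_nonneg_AE[OF nn] by simp
  qed
  have nn': "AE y in M. 0 \<le> (1 - P t (indicat_real A) y) * indicat_real A y"
    using nn by eventually_elim auto
  show "0 \<le> heat_loss t A"
    unfolding heat_loss_integral[OF assms] by (rule integral_nonneg_AE[OF nn'])
  have "ennreal (heat_loss t A)
      = (\<integral>\<^sup>+y. ennreal ((1 - P t (indicat_real A) y) * indicat_real A y) \<partial>M)"
    unfolding heat_loss_integral(2)[OF assms]
    by (rule nn_integral_eq_integral[OF heat_loss_integral(1)[OF assms] nn', symmetric])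
  also have "\<dots> = heat_flow t A (- A)"
    unfolding heat_flow_def using nn
    by (intro nn_integral_cong_AE) (auto elim!: AE_mp simp: indicator_def)
  finally show "ennreal (heat_loss t A) = heat_flow t A (- A)" .
qed

text \<open>The factor two counts the flow out of \<open>A\<close> and the equal flow into \<open>A\<close>.\<close>

lemma heat_variation_indicator:
  assumes [measurable]: "A \<in> sets M" and t: "0 < t" and fin: "emeasure M A < \<infinity>"
  shows "heat_variation M p t (indicat_real A) = 2 * ennreal (heat_loss t A)"
proof -
  have [measurable]: "- A \<in> sets M" using assms(1) by (simp add: sets_M)
  have "heat_variation M p t (indicat_real A)
     = (\<integral>\<^sup>+ y. (\<integral>\<^sup>+x\<in>- A. ennreal (p t y x) \<partial>M) * indicator A y
              + (\<integral>\<^sup>+x\<in>A. ennreal (p t y x) \<partial>M) * indicator (- A) y \<partial>M)"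
    unfolding heat_variation_def
  proof (rule nn_integral_cong)
    fix y
    have "(\<integral>\<^sup>+ x. ennreal (\<bar>indicat_real A x - indicat_real A y\<bar> * p t y x) \<partial>M)
       = (\<integral>\<^sup>+ x. ennreal (p t y x) * (if y \<in> A then indicator (- A) x else indicator A x) \<partial>M)"
      by (intro nn_integral_cong) (auto simp: indicator_def)
    then show "(\<integral>\<^sup>+ x. ennreal (\<bar>indicat_real A x - indicat_real A y\<bar> * p t y x) \<partial>M)
       = (\<integral>\<^sup>+x\<in>- A. ennreal (p t y x) \<partial>M) * indicator A y
              + (\<integral>\<^sup>+x\<in>A. ennreal (p t y x) \<partial>M) * indicator (- A) y"
      by (cases "y \<in> A") auto
  qed
  also have "\<dots> = heat_flow t A (- A) + heat_flow t (- A) A"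
    unfolding heat_flow_def using t by (subst nn_integral_add) measurable
  also have "\<dots> = 2 * ennreal (heat_loss t A)"
    using heat_flow_symmetric_compl[OF assms] heat_loss_eq_flow[OF t assms(1) fin]
    by (simp add: mult_2)
  finally show ?thesis .
qed


lemma heat_content_eq_norm:
  assumes t: "0 < t" and u: "u \<in> L2 M"
  shows "l2_inner M (P t u) u = l2_inner M (P (t / 2) u) (P (t / 2) u)"
proof -
  have h: "0 < t / 2" using t by simp
  have "l2_inner M (P t u) u = l2_inner M (P (t / 2) (P (t / 2) u)) u"
    using P_semigroup[OF h h u] t by (intro l2_inner_cong P_L2 u h) auto
  also have "\<dots> = l2_inner M (P (t / 2) u) (P (t / 2) u)"
    by (intro P_self_adjoint P_L2 u h)
  finally show ?thesis .
qed

text \<open>The semigroup is a contraction and the heat content is a squared norm, by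
  \<open>heat_content_eq_norm\<close>.\<close>

lemma heat_loss_mono:
  assumes "0 < s" "s \<le> t" "A \<in> sets M" "emeasure M A < \<infinity>"
  shows "heat_loss s A \<le> heat_loss t A"
proof (cases "s = t")
  case False
  let ?u = "indicat_real A"
  have h: "0 < (t - s) / 2" "0 < s / 2" "0 < t / 2" using assms False by auto
  have u: "?u \<in> L2 M" using assms by (intro indicator_L2)
  have ae: "AE x in M. P (t / 2) ?u x = P ((t - s) / 2) (P (s / 2) ?u) x"
    using P_semigroup[OF h(1,2) u] by (simp add: field_simps)
  have L: "P (t / 2) ?u \<in> L2 M" "P ((t - s) / 2) (P (s / 2) ?u) \<in> L2 M"
    by (intro P_L2 h u)+
  have "l2_inner M (P (t / 2) ?u) (P (t / 2) ?u)
      = l2_inner M (P ((t - s) / 2) (P (s / 2) ?u)) (P ((t - s) / 2) (P (s / 2) ?u))"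
    using l2_inner_cong[OF ae L L(1)] l2_inner_cong[OF ae L L(2)]
    by (simp add: l2_inner_def mult.commute)
  also have "\<dots> \<le> l2_inner M (P (s / 2) ?u) (P (s / 2) ?u)"
    using P_contraction[OF h(1) P_L2[OF h(2) u]] by (simp add: l2_norm_def)
  finally show ?thesis
    using assms by (simp add: heat_loss_def heat_content_eq_norm u)
qed simp

text \<open>The difference of the two sides is the squared norm of \<open>u - P\<^sub>t u\<close>.\<close>

lemma heat_loss_double:
  assumes t: "0 < t" and A: "A \<in> sets M" "emeasure M A < \<infinity>"
  shows "heat_loss (2 * t) A \<le> 2 * heat_loss t A"
proof -
  let ?u = "indicat_real A"
  have u: "?u \<in> L2 M" using A by (intro indicator_L2)
  have Pu: "P t ?u \<in> L2 M" by (intro P_L2 u t)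
  have "0 \<le> (\<integral>x. (?u x - P t ?u x)\<^sup>2 \<partial>M)" by simp
  also have "\<dots> = (\<integral>x. ?u x * ?u x - 2 * (P t ?u x * ?u x) + P t ?u x * P t ?u x \<partial>M)"
    by (simp add: power2_eq_square algebra_simps)
  also have "\<dots> = (\<integral>x. ?u x * ?u x \<partial>M) - 2 * l2_inner M (P t ?u) ?u + l2_inner M (P t ?u) (P t ?u)"
    unfolding l2_inner_def
    by (simp add: L2_mult_integrable[OF u u] L2_mult_integrable[OF Pu u] L2_mult_integrable[OF Pu Pu])
  also have "(\<integral>x. ?u x * ?u x \<partial>M) = measure M A"
    using A by (simp flip: indicator_inter_arith)
  also have "l2_inner M (P t ?u) (P t ?u) = l2_inner M (P (2 * t) ?u) ?u"
    using heat_content_eq_norm[of "2 * t" ?u] t u by simp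
  finally show ?thesis by (simp add: heat_loss_def)
qed

section \<open>Heat loss at a larger time\<close>

text \<open>Split \<open>v = P\<^sub>s u\<close> into \<open>w\<close>, its part on \<open>A\<close>, and
  \<open>z\<close>, its part off \<open>A\<close>. The increment is
  \<open>\<langle>v, u\<rangle> - \<langle>P\<^sub>t v, u\<rangle>\<close>, and moving
  \<open>P\<^sub>t\<close> from \<open>w\<close> to \<open>u\<close> by symmetry removes the
  contribution of \<open>A \<times> A\<close>. What remains is the integral of
  \<open>p\<^sub>t(y,x) (v(y) - v(x))\<close> over \<open>y \<in> A\<close>,
  \<open>x \<notin> A\<close>.\<close>

lemma heat_loss_increment:
  assumes s: "0 < s" and t: "0 < t" and r: "0 < r"
    and A: "A \<in> sets M" "emeasure M A < \<infinity>"
    and le: "AE y in M. AE x in M.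
      p t y x * (P s (indicat_real A) y - P s (indicat_real A) x) \<le> B * p r y x"
  shows "heat_loss (s + t) A - heat_loss s A \<le> B * heat_loss r A"
proof -
  let ?u = "indicat_real A" and ?v = "P s (indicat_real A)"
  define w where "w = (\<lambda>x. indicator A x * ?v x)"
  define z where "z = (\<lambda>x. indicator (- A) x * ?v x)"
  have nA: "- A \<in> sets M" using A by (simp add: sets_M)
  have u: "?u \<in> L2 M" using A by (intro indicator_L2)
  have v: "?v \<in> L2 M" by (intro P_L2 u s)
  have w: "w \<in> L2 M" unfolding w_def by (intro L2_mult_indicator v A)
  have z: "z \<in> L2 M" unfolding z_def by (intro L2_mult_indicator v nA)
  have vwz: "(\<lambda>x. w x + z x) = ?v" by (auto simp: w_def z_def indicator_def)
  have Pv: "AE x in M. P t ?v x = P t w x + P t z x"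
    using P_add[OF t w z] by (simp add: vwz)
  have ae: "AE x in M. P (s + t) ?u x = P t w x + P t z x"
    using P_semigroup[OF t s u] Pv by eventually_elim (simp add: add.commute)
  have int: "integrable M (\<lambda>y. ?v y * ?u y)" "integrable M (\<lambda>y. P t w y * ?u y)"
    "integrable M (\<lambda>y. P t z y * ?u y)" "integrable M (\<lambda>y. w y * P t ?u y)"
    by (intro L2_mult_integrable P_L2 u v w z s t)+
  have meas: "(\<lambda>y. P (s + t) ?u y * ?u y) \<in> borel_measurable M"
    using s t by (intro borel_measurable_integrable L2_mult_integrable P_L2 u) auto
  have "l2_inner M (P (s + t) ?u) ?u = (\<integral>y. P t w y * ?u y + P t z y * ?u y \<partial>M)"
    unfolding l2_inner_def
    by (rule integral_cong_AE) (use ae meas int in \<open>auto simp: algebra_simps intro!: borel_measurable_add borel_measurable_integrable\<close>)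
  also have "\<dots> = l2_inner M (P t w) ?u + (\<integral>y. P t z y * ?u y \<partial>M)"
    using int by (simp add: l2_inner_def)
  also have "l2_inner M (P t w) ?u = (\<integral>y. w y * P t ?u y \<partial>M)"
    using P_self_adjoint[OF t w u] by (simp add: l2_inner_def)
  finally have "heat_loss (s + t) A - heat_loss s A
      = (\<integral>y. ?v y * ?u y - w y * P t ?u y - P t z y * ?u y \<partial>M)"
    using int by (simp add: heat_loss_def l2_inner_def)
  also have "\<dots> \<le> (\<integral>y. B * ((1 - P r ?u y) * ?u y) \<partial>M)"
  proof (rule integral_mono_AE)
    show "integrable M (\<lambda>y. ?v y * ?u y - w y * P t ?u y - P t z y * ?u y)"
      using int by simp
    show "integrable M (\<lambda>y. B * ((1 - P r ?u y) * ?u y))"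
      using heat_loss_integral(1)[OF r A] by simp
    show "AE y in M. ?v y * ?u y - w y * P t ?u y - P t z y * ?u y \<le> B * ((1 - P r ?u y) * ?u y)"
      using one_minus_P_indicator[OF t A] one_minus_P_indicator[OF r A] P_kernel[OF t z] le
    proof eventually_elim
      case (elim y)
      show ?case
      proof (cases "y \<in> A")
        case True
        have it: "integrable M (\<lambda>x. ?v y * (p t y x * indicat_real (- A) x))"
          "integrable M (\<lambda>x. p t y x * z x)"
          using elim by simp_all
        have "?v y * ?u y - w y * P t ?u y - P t z y * ?u y = ?v y * (1 - P t ?u y) - P t z y"
          using True by (simp add: w_def algebra_simps)
        also have "\<dots> = (\<integral>x. ?v y * (p t y x * indicat_real (- A) x) - p t y x * z x \<partial>M)"
          using elim it by simp
        also have "\<dots> \<le> (\<integral>x. B * (p r y x * indicat_real (- A) x) \<partial>M)"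
        proof (rule integral_mono_AE)
          show "AE x in M. ?v y * (p t y x * indicat_real (- A) x) - p t y x * z x
              \<le> B * (p r y x * indicat_real (- A) x)"
            using elim(4) by eventually_elim (auto simp: z_def indicator_def algebra_simps)
        qed (use it elim in auto)
        also have "\<dots> = B * ((1 - P r ?u y) * ?u y)" using True elim by simp
        finally show ?thesis .
      qed (simp add: w_def)
    qed
  qed
  also have "\<dots> = B * heat_loss r A"
    using heat_loss_integral[OF r A] by simp
  finally show ?thesis .
qed


text \<open>With \<open>n\<close> the integer part of \<open>t/s\<close>, monotonicity bounds the heat loss at
  time \<open>t\<close> by that at \<open>(n + 1) s\<close>, which is the sum of \<open>n + 1\<close>
  increments over time steps of length \<open>s\<close>. The first one is just the heat loss at time
  \<open>s\<close>. The others start at the times \<open>k s \<le> t < R\<close>, where the Hoelder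
  estimate is available; they are of order \<open>k\<^sup>\<alpha>\<^sup>-\<^sup>1\<close> relative to
  the heat loss at time \<open>2\<^sup>j s\<close>, and these powers add up to order
  \<open>n\<^sup>\<alpha>\<close>.\<close>

lemma heat_loss_le_smaller_time:
  assumes \<alpha>: "0 < \<alpha>" "\<alpha> \<le> 1" and C: "0 < C"
    and holder: "\<And>t f x y. 0 < t \<Longrightarrow> ereal t < R \<Longrightarrow> f \<in> Linfty M \<Longrightarrow>
           \<bar>heat_op M p t f x - heat_op M p t f y\<bar>
             \<le> C * (dist x y powr (dW * (1 - \<alpha>)) / t powr (1 - \<alpha>)) * linfty_norm M f"
  obtains j :: nat and K where "0 < K"
    "\<And>s t A. 0 < s \<Longrightarrow> s \<le> t \<Longrightarrow> ereal t < R \<Longrightarrow> A \<in> sets M \<Longrightarrow> emeasure M A < \<infinity> \<Longrightarrow>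
       heat_loss t A \<le> K * (t / s) powr \<alpha> * heat_loss (2 ^ j * s) A"
proof -
  obtain j :: nat and A0 where A0: "0 < A0" and comp: "\<And>t. 0 < t \<Longrightarrow>
       AE y in M. AE x in M. p t y x \<le> A0 * exp (- (c4 / 2) * scaled_dist t y x) * p (2 ^ j * t) y x"
    by (rule kernel_comparison, rule that)
  obtain K0 where K0: "0 < K0"
    "\<And>x. 0 \<le> x \<Longrightarrow> x powr ((dW - 1) * (1 - \<alpha>)) * exp (- (c4 / 2) * x) \<le> K0"
  proof -
    have "0 < c4 / 2" "0 \<le> (dW - 1) * (1 - \<alpha>)" using pos dW \<alpha> by simp_all
    from powr_mult_exp_bounded[OF this] show ?thesis using that by blast
  qed
  define K where "K = C * K0 * A0"
  have K: "0 < K" using C K0 A0 by (simp add: K_def)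
  \<comment> \<open>The estimate holds at every point for the kernel version, hence almost everywhere
    for \<open>P s\<close>; the indicator has norm at most one.\<close>
  have holder_ae: "AE y in M. AE x in M. P s (indicat_real A) y - P s (indicat_real A) x
      \<le> C * (dist y x powr (dW * (1 - \<alpha>)) / s powr (1 - \<alpha>))"
    if s: "0 < s" "ereal s < R" and A: "A \<in> sets M" "emeasure M A < \<infinity>" for s A
  proof -
    have bdd: "esssup M (\<lambda>x. ereal \<bar>indicat_real A x\<bar>) \<le> 1"
      using A by (intro esssup_I) (auto simp: indicator_def one_ereal_def)
    have L: "indicat_real A \<in> Linfty M"
      using bdd A by (auto simp: Linfty_def)
    have "linfty_norm M (indicat_real A) \<le> 1"
      using bdd unfolding linfty_norm_def
      by (cases "esssup M (\<lambda>x. ereal \<bar>indicat_real A x\<bar>)") (auto simp: one_ereal_def)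
    then have *: "\<bar>heat_op M p s (indicat_real A) x - heat_op M p s (indicat_real A) y\<bar>
       \<le> C * (dist x y powr (dW * (1 - \<alpha>)) / s powr (1 - \<alpha>))" for x y
      using C by (intro order_trans[OF holder[OF s L]] mult_left_le) auto
    have eq: "AE x in M. P s (indicat_real A) x = heat_op M p s (indicat_real A) x"
      using P_kernel[OF s(1) indicator_L2[OF A]] by eventually_elim (simp add: heat_op_def)
    show ?thesis
      using eq
    proof eventually_elim
      case (elim y)
      show ?case using eq by eventually_elim (use * elim abs_le_D1 in fastforce)
    qed
  qed
  have increment: "heat_loss (s + \<tau>) A - heat_loss s A
      \<le> K * (\<tau> / s) powr (1 - \<alpha>) * heat_loss (2 ^ j * \<tau>) A"
    if s: "0 < s" "ereal s < R" and \<tau>: "0 < \<tau>" and A: "A \<in> sets M" "emeasure M A < \<infinity>" for s \<tau> A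
  proof (rule heat_loss_increment)
    show "AE y in M. AE x in M. p \<tau> y x * (P s (indicat_real A) y - P s (indicat_real A) x)
        \<le> K * (\<tau> / s) powr (1 - \<alpha>) * p (2 ^ j * \<tau>) y x"
      using holder_ae[OF s A] comp[OF \<tau>] kernel_pos
    proof eventually_elim
      case (elim y)
      then show ?case
      proof eventually_elim
        case (elim x)
        let ?\<theta> = "scaled_dist \<tau> y x"
        have pp: "0 < p \<tau> y x" "0 < p (2 ^ j * \<tau>) y x" using elim \<tau> by auto
        have "dist y x powr (dW * (1 - \<alpha>)) = (\<tau> * (dist y x powr dW / \<tau>)) powr (1 - \<alpha>)"
          using \<tau> by (simp add: powr_powr)
        also have "\<dots> = \<tau> powr (1 - \<alpha>) * ?\<theta> powr ((dW - 1) * (1 - \<alpha>))"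
          using \<tau> dW by (subst powr_mult) (auto simp: scaled_dist_def powr_powr)
        finally have d: "dist y x powr (dW * (1 - \<alpha>)) / s powr (1 - \<alpha>)
            = (\<tau> / s) powr (1 - \<alpha>) * ?\<theta> powr ((dW - 1) * (1 - \<alpha>))"
          using s \<tau> by (simp add: powr_divide)
        have "p \<tau> y x * (P s (indicat_real A) y - P s (indicat_real A) x)
            \<le> p \<tau> y x * (C * (\<tau> / s) powr (1 - \<alpha>) * ?\<theta> powr ((dW - 1) * (1 - \<alpha>)))"
          using elim(1) pp unfolding d by (intro mult_left_mono) (auto simp: mult.assoc)
        also have "\<dots> \<le> A0 * exp (- (c4 / 2) * ?\<theta>) * p (2 ^ j * \<tau>) y x
            * (C * (\<tau> / s) powr (1 - \<alpha>) * ?\<theta> powr ((dW - 1) * (1 - \<alpha>)))"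
          using elim(2) C by (intro mult_right_mono) auto
        also have "\<dots> = (?\<theta> powr ((dW - 1) * (1 - \<alpha>)) * exp (- (c4 / 2) * ?\<theta>))
            * (A0 * C * (\<tau> / s) powr (1 - \<alpha>) * p (2 ^ j * \<tau>) y x)"
          by (simp add: mult_ac)
        also have "\<dots> \<le> K0 * (A0 * C * (\<tau> / s) powr (1 - \<alpha>) * p (2 ^ j * \<tau>) y x)"
          using A0 C pp by (intro mult_right_mono K0) (auto simp: scaled_dist_def)
        finally show ?case by (simp add: K_def mult_ac)
      qed
    qed
  qed (use s \<tau> A in auto)
  show thesis
  proof (rule that[of "1 + K / \<alpha>" j])
    show "0 < 1 + K / \<alpha>" using K \<alpha> by (simp add: add_pos_pos)
    fix s t :: real and A assume s: "0 < s" "s \<le> t" and t: "ereal t < R"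
      and A: "A \<in> sets M" "emeasure M A < \<infinity>"
    let ?a = "heat_loss (2 ^ j * s) A"
    have a: "0 \<le> ?a" using s A by (intro heat_loss_eq_flow) auto
    have telescope: "heat_loss ((real n + 1) * s) A \<le> (1 + K * real n powr \<alpha> / \<alpha>) * ?a"
      if "real n * s \<le> t" for n
      using that
    proof (induction n)
      case 0
      have "s \<le> 2 ^ j * s" using s by simp
      then show ?case using heat_loss_mono[OF s(1) _ A] by simp
    next
      case (Suc n)
      have ns: "(real n + 1) * s \<le> t" using Suc.prems by (simp add: add.commute)
      have IH: "heat_loss ((real n + 1) * s) A \<le> (1 + K * real n powr \<alpha> / \<alpha>) * ?a"
        using ns s by (intro Suc.IH) (auto simp: algebra_simps)
      have "ereal ((real n + 1) * s) < R"
        using ns t by (meson ereal_less_eq(3) le_less_trans)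
      then have "heat_loss ((real n + 1) * s + s) A - heat_loss ((real n + 1) * s) A
          \<le> K * (s / ((real n + 1) * s)) powr (1 - \<alpha>) * ?a"
        using s A by (intro increment) auto
      also have "s / ((real n + 1) * s) = inverse (real n + 1)" using s by (simp add: inverse_eq_divide)
      also have "\<dots> powr (1 - \<alpha>) = (real n + 1) powr (\<alpha> - 1)"
        by (simp add: powr_minus[symmetric] powr_def ln_inverse) (simp add: algebra_simps)
      also have "K * (real n + 1) powr (\<alpha> - 1) * ?a
          \<le> K * (((real n + 1) powr \<alpha> - real n powr \<alpha>) / \<alpha>) * ?a"
        using powr_increment_ge[of "real n" \<alpha>] \<alpha> K a
        by (intro mult_left_mono mult_right_mono) (auto simp: field_simps)
      finally have "heat_loss ((real n + 1) * s + s) A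
          \<le> (1 + K * real n powr \<alpha> / \<alpha>) * ?a + K * (((real n + 1) powr \<alpha> - real n powr \<alpha>) / \<alpha>) * ?a"
        using IH by linarith
      also have "\<dots> = (1 + K * real (Suc n) powr \<alpha> / \<alpha>) * ?a"
        using \<alpha> by (simp add: field_simps)
      finally show ?case by (simp add: algebra_simps)
    qed
    define n where "n = nat \<lfloor>t / s\<rfloor>"
    have ts: "1 \<le> t / s" using s by simp
    have n: "real n \<le> t / s" "t / s \<le> real n + 1"
      using ts unfolding n_def by (auto simp: of_nat_nat)
    have "heat_loss t A \<le> heat_loss ((real n + 1) * s) A"
      using n s by (intro heat_loss_mono A) (auto simp: field_simps)
    also have "\<dots> \<le> (1 + K * real n powr \<alpha> / \<alpha>) * ?a"
      using n s by (intro telescope) (auto simp: field_simps)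
    also have "\<dots> \<le> ((t / s) powr \<alpha> + K * (t / s) powr \<alpha> / \<alpha>) * ?a"
      using a n K \<alpha> ts
      by (intro mult_right_mono add_mono divide_right_mono mult_left_mono powr_mono2 ge_one_powr_ge_zero) auto
    also have "\<dots> = (1 + K / \<alpha>) * (t / s) powr \<alpha> * ?a" by (simp add: algebra_simps)
    finally show "heat_loss t A \<le> (1 + K / \<alpha>) * (t / s) powr \<alpha> * heat_loss (2 ^ j * s) A" .
  qed
qed


section \<open>Layer cake decomposition of the heat variation\<close>

lemma heat_variation_pair:
  assumes [measurable]: "f \<in> borel_measurable M" and t: "0 < t"
  shows "heat_variation M p t f
    = (\<integral>\<^sup>+z. ennreal (\<bar>f (snd z) - f (fst z)\<bar> * p t (fst z) (snd z)) \<partial>(M \<Otimes>\<^sub>M M))"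
proof -
  have "(\<lambda>z. ennreal (\<bar>f (snd z) - f (fst z)\<bar> * p t (fst z) (snd z))) \<in> borel_measurable (M \<Otimes>\<^sub>M M)"
    using t by measurable
  from nn_integral_fst[OF this] show ?thesis by (simp add: heat_variation_def)
qed

text \<open>The conditional form of the integrand makes the measurability in the level \<open>s\<close> visible.\<close>

lemma layer_measurable:
  fixes f :: "'a \<Rightarrow> real"
  assumes [measurable]: "f \<in> borel_measurable M" and t: "0 < t"
  shows "(\<lambda>(z, s). ennreal (\<bar>indicat_real {x. s < f x} (snd z) - indicat_real {x. s < f x} (fst z)\<bar>
      * p t (fst z) (snd z))) \<in> borel_measurable ((M \<Otimes>\<^sub>M M) \<Otimes>\<^sub>M lborel)"
proof -
  have "(\<lambda>(z, s). ennreal (\<bar>(if s < f (snd z) then 1 else 0) - (if s < f (fst z) then 1 else 0 :: real)\<bar>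
      * p t (fst z) (snd z))) \<in> borel_measurable ((M \<Otimes>\<^sub>M M) \<Otimes>\<^sub>M lborel)"
    using t by measurable
  then show ?thesis by (simp add: indicator_def of_bool_def)
qed

lemma superlevel_measurable:
  fixes f :: "'a \<Rightarrow> real"
  assumes "f \<in> borel_measurable M"
  shows "{x. s < f x} \<in> sets M"
proof -
  have "{x \<in> space M. s < f x} \<in> sets M" using assms by measurable
  then show ?thesis by simp
qed

text \<open>Each difference \<open>\<bar>f x - f y\<bar>\<close> is the length of the set of levels that
  separate \<open>f x\<close> from \<open>f y\<close>; then Tonelli.\<close>

lemma coarea:
  assumes f[measurable]: "f \<in> borel_measurable M" and t: "0 < t"
  shows "heat_variation M p t f = (\<integral>\<^sup>+s. heat_variation M p t (indicat_real {x. s < f x}) \<partial>lborel)"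
    and "(\<lambda>s. heat_variation M p t (indicat_real {x. s < f x})) \<in> borel_measurable lborel"
proof -
  interpret L: pair_sigma_finite "M \<Otimes>\<^sub>M M" lborel ..
  define h where "h z s = ennreal (\<bar>indicat_real {x. s < f x} (snd z) - indicat_real {x. s < f x} (fst z)\<bar>
      * p t (fst z) (snd z))" for z s
  have hm: "case_prod h \<in> borel_measurable ((M \<Otimes>\<^sub>M M) \<Otimes>\<^sub>M lborel)"
    using layer_measurable[OF f t] by (simp add: h_def[abs_def])
  have hv: "heat_variation M p t (indicat_real {x. s < f x}) = (\<integral>\<^sup>+z. h z s \<partial>(M \<Otimes>\<^sub>M M))" for s
    unfolding h_def
    by (rule heat_variation_pair[OF _ t]) (use superlevel_measurable[OF f] in measurable)
  have "heat_variation M p t f = (\<integral>\<^sup>+z. (\<integral>\<^sup>+s. h z s \<partial>lborel) \<partial>(M \<Otimes>\<^sub>M M))"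
    unfolding heat_variation_pair[OF f t]
  proof (rule nn_integral_cong)
    fix z
    have "(\<lambda>s. ennreal \<bar>(if s < f (snd z) then 1 else 0) - (if s < f (fst z) then 1 else 0 :: real)\<bar>)
       \<in> borel_measurable lborel" by measurable
    then have "(\<lambda>s. ennreal \<bar>indicat_real {s<..} (f (snd z)) - indicat_real {s<..} (f (fst z))\<bar>)
       \<in> borel_measurable lborel" by (simp add: indicator_def)
    then have "(\<integral>\<^sup>+s. h z s \<partial>lborel) = ennreal \<bar>f (snd z) - f (fst z)\<bar> * ennreal (p t (fst z) (snd z))"
      unfolding abs_diff_eq_layers[of "f (snd z)" "f (fst z)"] h_def
      by (subst nn_integral_multc[symmetric]) (auto simp: indicator_def ennreal_mult' intro!: nn_integral_cong)
    then show "ennreal (\<bar>f (snd z) - f (fst z)\<bar> * p t (fst z) (snd z)) = (\<integral>\<^sup>+s. h z s \<partial>lborel)"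
      by (simp add: ennreal_mult')
  qed
  also have "\<dots> = (\<integral>\<^sup>+s. (\<integral>\<^sup>+z. h z s \<partial>(M \<Otimes>\<^sub>M M)) \<partial>lborel)"
    using L.Fubini'[OF hm] by simp
  finally show "heat_variation M p t f = (\<integral>\<^sup>+s. heat_variation M p t (indicat_real {x. s < f x}) \<partial>lborel)"
    by (simp add: hv)
  have "(\<lambda>s. \<integral>\<^sup>+z. h z s \<partial>(M \<Otimes>\<^sub>M M)) \<in> borel_measurable lborel"
    using hm by (intro pair.P.borel_measurable_nn_integral) (simp add: measurable_pair_swap_iff[of h])
  then show "(\<lambda>s. heat_variation M p t (indicat_real {x. s < f x})) \<in> borel_measurable lborel"
    by (simp add: hv)
qed

lemma heat_variation_compl:
  "heat_variation M p t (indicat_real (- A)) = heat_variation M p t (indicat_real A)"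
  unfolding heat_variation_def
  by (intro nn_integral_cong arg_cong[where f=ennreal] arg_cong2[where f="(*)"] refl)
    (auto simp: indicator_def)

text \<open>Linear inequalities between heat variations at two times may be checked on sets of finite measure. A
  superlevel set of an integrable function has finite measure if the level is positive and a
  complement of finite measure if it is negative, and complementing a set does not change the heat
  variation. The level zero is a null set.\<close>

lemma heat_variation_transfer:
  assumes s: "0 < s" and t: "0 < t" and f: "integrable M f"
    and sets: "\<And>A. A \<in> sets M \<Longrightarrow> emeasure M A < \<infinity> \<Longrightarrow>
      heat_variation M p s (indicat_real A) \<le> k * heat_variation M p t (indicat_real A)"
  shows "heat_variation M p s f \<le> k * heat_variation M p t f"
proof -
  have fm[measurable]: "f \<in> borel_measurable M" using f by auto
  have level[measurable]: "{x. r \<le> \<bar>f x\<bar>} \<in> sets M" for r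
  proof -
    have "{x \<in> space M. r \<le> \<bar>f x\<bar>} \<in> sets M" by measurable
    then show ?thesis by simp
  qed
  have fin: "emeasure M {x. r \<le> \<bar>f x\<bar>} < \<infinity>" if "0 < r" for r
    using integral_Markov_inequality[of M "\<lambda>x. \<bar>f x\<bar>" r] f that
    by (auto intro: le_less_trans)
  have "heat_variation M p s (indicat_real {x. r < f x}) \<le> k * heat_variation M p t (indicat_real {x. r < f x})"
    if "r \<noteq> 0" for r
  proof (cases "0 < r")
    case True
    have "emeasure M {x. r < f x} \<le> emeasure M {x. r \<le> \<bar>f x\<bar>}"
      by (intro emeasure_mono level) auto
    then have "emeasure M {x. r < f x} < \<infinity>" using fin[OF True] by (rule le_less_trans)
    then show ?thesis by (intro sets superlevel_measurable fm)
  next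
    case False
    then have r: "0 < - r" using that by simp
    have [measurable]: "- {x. r < f x} \<in> sets M"
      using superlevel_measurable[OF fm, of r] by (simp add: sets_M)
    have "emeasure M (- {x. r < f x}) \<le> emeasure M {x. - r \<le> \<bar>f x\<bar>}"
      by (intro emeasure_mono level) auto
    then have "emeasure M (- {x. r < f x}) < \<infinity>" using fin[OF r] by (rule le_less_trans)
    then have "heat_variation M p s (indicat_real (- {x. r < f x}))
        \<le> k * heat_variation M p t (indicat_real (- {x. r < f x}))"
      by (intro sets) auto
    then show ?thesis by (simp add: heat_variation_compl)
  qed
  then have "AE r in lborel. heat_variation M p s (indicat_real {x. r < f x})
      \<le> k * heat_variation M p t (indicat_real {x. r < f x})"
    using AE_lborel_singleton[of 0] by (auto elim!: AE_mp)
  then have "heat_variation M p s f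
      \<le> (\<integral>\<^sup>+r. k * heat_variation M p t (indicat_real {x. r < f x}) \<partial>lborel)"
    unfolding coarea(1)[OF fm s] by (rule nn_integral_mono_AE)
  also have "\<dots> = k * heat_variation M p t f"
    unfolding coarea(1)[OF fm t] by (intro nn_integral_cmult coarea(2) fm t)
  finally show ?thesis .
qed

lemma heat_variation_double:
  assumes t: "0 < t" and f: "integrable M f"
  shows "heat_variation M p (2 * t) f \<le> 2 * heat_variation M p t f"
proof (rule heat_variation_transfer[OF _ t f])
  fix A assume A: "A \<in> sets M" "emeasure M A < \<infinity>"
  have "ennreal (heat_loss (2 * t) A) \<le> ennreal (2 * heat_loss t A)"
    by (intro ennreal_leI heat_loss_double t A)
  also have "\<dots> = 2 * ennreal (heat_loss t A)"
    using heat_loss_eq_flow(1)[OF t A] by (simp add: ennreal_mult)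
  finally have "2 * ennreal (heat_loss (2 * t) A) \<le> 2 * (2 * ennreal (heat_loss t A))"
    by (rule mult_left_mono) simp
  then show "heat_variation M p (2 * t) (indicat_real A) \<le> 2 * heat_variation M p t (indicat_real A)"
    using t A by (subst (1 2) heat_variation_indicator) auto
qed (use t in simp)

lemma heat_variation_power2:
  assumes t: "0 < t" and f: "integrable M f"
  shows "heat_variation M p (2 ^ n * t) f \<le> 2 ^ n * heat_variation M p t f"
proof (induction n)
  case (Suc n)
  have "heat_variation M p (2 * (2 ^ n * t)) f \<le> 2 * heat_variation M p (2 ^ n * t) f"
    using t by (intro heat_variation_double f) simp
  also have "\<dots> \<le> 2 * (2 ^ n * heat_variation M p t f)"
    using Suc by (intro mult_left_mono) auto
  finally show ?case by (simp add: mult.assoc)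
qed simp

section \<open>The critical exponent is at most one\<close>

lemma besov_bound:
  assumes "f \<in> besov M p \<alpha>"
  obtains K \<delta> where "0 < \<delta>" "0 \<le> K"
    "\<And>t. 0 < t \<Longrightarrow> t < \<delta> \<Longrightarrow> heat_variation M p t f \<le> ennreal (K * t powr \<alpha>)"
proof -
  have "Limsup (at_right 0) (\<lambda>t. ennreal (t powr (- \<alpha>)) * heat_variation M p t f) < top"
    using assms by (auto simp: besov_def)
  then obtain l where l: "0 \<le> l"
    "Limsup (at_right 0) (\<lambda>t. ennreal (t powr (- \<alpha>)) * heat_variation M p t f) = ennreal l"
    by (cases "Limsup (at_right 0) (\<lambda>t. ennreal (t powr (- \<alpha>)) * heat_variation M p t f)") auto
  define K where "K = l + 1"
  have K0: "0 \<le> K" using l by (simp add: K_def)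
  have K: "Limsup (at_right 0) (\<lambda>t. ennreal (t powr (- \<alpha>)) * heat_variation M p t f) < ennreal K"
    using l by (simp add: K_def ennreal_less_iff)
  from Limsup_lessD[OF K] obtain \<delta> where \<delta>: "0 < \<delta>"
    "\<And>t. 0 < t \<Longrightarrow> t < \<delta> \<Longrightarrow> ennreal (t powr (- \<alpha>)) * heat_variation M p t f < ennreal K"
    unfolding eventually_at_right_field by auto
  show thesis
  proof (rule that[OF \<delta>(1) K0])
    fix t :: real assume t: "0 < t" "t < \<delta>"
    have "heat_variation M p t f = ennreal (t powr \<alpha>) * (ennreal (t powr (- \<alpha>)) * heat_variation M p t f)"
      using t by (simp add: mult.assoc[symmetric] ennreal_mult[symmetric] powr_add[symmetric])
    also have "\<dots> \<le> ennreal (t powr \<alpha>) * ennreal K"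
      using \<delta>(2)[OF t] by (intro mult_left_mono) auto
    finally show "heat_variation M p t f \<le> ennreal (K * t powr \<alpha>)"
      using K0 by (simp add: ennreal_mult mult.commute)
  qed
qed

text \<open>Membership in the Besov space controls small times only; repeated doubling of the time reaches all
  others.\<close>

lemma heat_variation_finite:
  assumes f: "f \<in> besov M p \<alpha>" and t: "0 < t"
  shows "heat_variation M p t f < \<infinity>"
proof -
  have fi: "integrable M f" using f by (simp add: besov_def)
  obtain K \<delta> where K: "0 < \<delta>" "0 \<le> K"
    "\<And>t. 0 < t \<Longrightarrow> t < \<delta> \<Longrightarrow> heat_variation M p t f \<le> ennreal (K * t powr \<alpha>)"
    by (rule besov_bound[OF f], rule that)
  obtain n where n: "t / 2 ^ n < \<delta>" by (rule halving_below[OF t K(1)]) blast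
  have "heat_variation M p (2 ^ n * (t / 2 ^ n)) f \<le> 2 ^ n * heat_variation M p (t / 2 ^ n) f"
    using t by (intro heat_variation_power2 fi) simp
  also have "\<dots> \<le> 2 ^ n * ennreal (K * (t / 2 ^ n) powr \<alpha>)"
    using K(3)[of "t / 2 ^ n"] n t by (intro mult_left_mono) auto
  also have "\<dots> = ennreal (2 ^ n * (K * (t / 2 ^ n) powr \<alpha>))"
    using K(2) by (simp add: ennreal_mult ennreal_power[symmetric])
  also have "\<dots> < \<infinity>" by simp
  finally show ?thesis by simp
qed

lemma AE_const_of_heat_variation_zero:
  assumes fm[measurable]: "f \<in> borel_measurable M" and t: "0 < t" and zero: "heat_variation M p t f = 0"
  shows "\<exists>c. AE x in M. f x = c"
proof -
  have "AE y in M. (\<integral>\<^sup>+ x. ennreal (\<bar>f x - f y\<bar> * p t y x) \<partial>M) = 0"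
    using zero t unfolding heat_variation_def by (subst (asm) nn_integral_0_iff_AE) measurable
  then have "AE y in M. AE x in M. f x = f y"
    using kernel_pos
  proof eventually_elim
    case (elim y)
    have "AE x in M. ennreal (\<bar>f x - f y\<bar> * p t y x) = 0"
      using elim(1) t by (subst (asm) nn_integral_0_iff_AE) measurable
    then show ?case
      using elim(2)
    proof eventually_elim
      case (elim x)
      then have "\<bar>f x - f y\<bar> * p t y x \<le> 0" "0 < p t y x" using t by (auto simp: ennreal_eq_0_iff)
      then show ?case by (simp add: mult_le_0_iff)
    qed
  qed
  moreover have "ae_filter M \<noteq> bot"
  proof -
    obtain x0 :: 'a where True by simp
    have "0 < measure M (ball x0 1)" by (rule measure_ball_pos) simp
    then have "emeasure M (ball x0 1) \<noteq> 0" by (auto simp: measure_def)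
    then have "emeasure M (space M) \<noteq> 0"
      using emeasure_mono[OF sets.sets_into_space[OF ball_in_sets[of x0 1]] sets.top]
      by auto
    then show ?thesis by (simp add: ae_filter_eq_bot_iff)
  qed
  ultimately obtain y where "AE x in M. f x = f y"
    using eventually_happens' by blast
  then show ?thesis by blast
qed

text \<open>The heat variation grows at most linearly under doubling of the time. Starting from
  \<open>2\<^sup>-\<^sup>n\<close>, where it is of order
  \<open>2\<^sup>-\<^sup>n\<^sup>\<alpha>\<close>, its value at time one is of order
  \<open>2 powr (n * (1 - \<alpha>))\<close>, for every \<open>n\<close>.\<close>

lemma besov_trivial:
  assumes f: "f \<in> besov M p \<alpha>" and \<alpha>: "1 < \<alpha>"
  shows "\<exists>c. AE x in M. f x = c"
proof (rule AE_const_of_heat_variation_zero)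
  have fi: "integrable M f" using f by (simp add: besov_def)
  then show "f \<in> borel_measurable M" by auto
  show "(0 :: real) < 1" by simp
  obtain K \<delta> where K: "0 < \<delta>" "0 \<le> K"
    "\<And>t. 0 < t \<Longrightarrow> t < \<delta> \<Longrightarrow> heat_variation M p t f \<le> ennreal (K * t powr \<alpha>)"
    by (rule besov_bound[OF f], rule that)
  obtain N where N: "\<And>n. N \<le> n \<Longrightarrow> 1 / 2 ^ n < \<delta>" by (rule halving_below[OF zero_less_one K(1)]) blast
  have le: "heat_variation M p 1 f \<le> ennreal (K * (2 powr (1 - \<alpha>)) ^ n)" if "N \<le> n" for n
  proof -
    have "heat_variation M p (2 ^ n * (1 / 2 ^ n)) f \<le> 2 ^ n * heat_variation M p (1 / 2 ^ n) f"
      by (intro heat_variation_power2 fi) simp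
    also have "\<dots> \<le> 2 ^ n * ennreal (K * (1 / 2 ^ n) powr \<alpha>)"
      using K(3)[of "1 / 2 ^ n"] N[OF that] by (intro mult_left_mono) auto
    also have "\<dots> = ennreal (2 ^ n * (K * (1 / 2 ^ n) powr \<alpha>))"
      using K(2) by (simp add: ennreal_mult ennreal_power[symmetric])
    also have "2 ^ n * (K * (1 / 2 ^ n) powr \<alpha>) = K * (2 powr (1 - \<alpha>)) ^ n"
      by (simp add: powr_divide powr_diff powr_powr mult.commute flip: powr_realpow)
    finally show ?thesis by simp
  qed
  have "(\<lambda>n. ennreal (K * (2 powr (1 - \<alpha>)) ^ n)) \<longlonglongrightarrow> ennreal (K * 0)"
    using \<alpha> by (intro tendsto_ennrealI tendsto_intros LIMSEQ_power_zero) (auto simp: powr_less_one)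
  from LIMSEQ_le_const[OF this, of "heat_variation M p 1 f"] le
  have "heat_variation M p 1 f \<le> ennreal (K * 0)" by blast
  then show "heat_variation M p 1 f = 0" by simp
qed

lemma critical_exponent_le_1: "critical_exponent M p \<le> 1"
  unfolding critical_exponent_def
  using besov_trivial by (intro SUP_least) (force simp: one_ereal_def)


section \<open>Comparison with averages over balls\<close>

text \<open>At distance less than \<open>r\<close> and time \<open>r powr dW\<close>, the scaled distance is at
  most one, so that the kernel is bounded below by a multiple of the reciprocal volume of the ball.\<close>

lemma ball_variation_le_heat_variation:
  assumes f[measurable]: "f \<in> borel_measurable M" and r: "0 < r"
  shows "ball_variation M dW \<alpha> r f
    \<le> ennreal (exp c2 / c1 * (r powr dW) powr (- \<alpha>)) * heat_variation M p (r powr dW) f"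
proof -
  let ?t = "r powr dW" and ?k = "exp c2 / c1 * (r powr dW) powr (- \<alpha>)"
  have t: "0 < ?t" using r by simp
  have tr: "?t powr (1 / dW) = r" using r dW by (simp add: powr_powr)
  have "ball_variation M dW \<alpha> r f
      \<le> (\<integral>\<^sup>+y. (\<integral>\<^sup>+x. ennreal ?k * ennreal (\<bar>f x - f y\<bar> * p ?t y x) \<partial>M) \<partial>M)"
    unfolding ball_variation_def
  proof (rule nn_integral_mono_AE)
    show "AE y in M. (\<integral>\<^sup>+x\<in>ball y r. ennreal (\<bar>f x - f y\<bar> / (r powr (\<alpha> * dW) * measure M (ball y r))) \<partial>M)
      \<le> (\<integral>\<^sup>+x. ennreal ?k * ennreal (\<bar>f x - f y\<bar> * p ?t y x) \<partial>M)"
      using kernel_bounds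
    proof eventually_elim
      case (elim y)
      have V: "0 < measure M (ball y r)" using r by (rule measure_ball_pos)
      show ?case
      proof (rule nn_integral_mono_AE)
        show "AE x in M. ennreal (\<bar>f x - f y\<bar> / (r powr (\<alpha> * dW) * measure M (ball y r))) * indicator (ball y r) x
          \<le> ennreal ?k * ennreal (\<bar>f x - f y\<bar> * p ?t y x)"
          using elim
        proof eventually_elim
          case (elim x)
          show ?case
          proof (cases "x \<in> ball y r")
            case True
            have "dist y x powr dW / ?t \<le> 1"
              using True r dW by (simp add: powr_mono2)
            then have "(dist y x powr dW / ?t) powr (1 / (dW - 1)) \<le> 1 powr (1 / (dW - 1))"
              using dW by (intro powr_mono2) auto
            then have "c1 / measure M (ball y r) * exp (- c2)
                \<le> c1 / measure M (ball y r) * exp (- c2 * (dist y x powr dW / ?t) powr (1 / (dW - 1)))"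
              using pos V by (intro mult_left_mono) auto
            also have "\<dots> \<le> p ?t y x" using elim[rule_format, OF t] by (simp add: tr)
            finally have "1 / measure M (ball y r) \<le> exp c2 / c1 * p ?t y x"
              using pos V by (simp add: exp_minus field_simps)
            then have "\<bar>f x - f y\<bar> * (r powr dW) powr (- \<alpha>) * (1 / measure M (ball y r))
                \<le> \<bar>f x - f y\<bar> * (r powr dW) powr (- \<alpha>) * (exp c2 / c1 * p ?t y x)"
              by (intro mult_left_mono) auto
            then have "\<bar>f x - f y\<bar> / (r powr (\<alpha> * dW) * measure M (ball y r))
                \<le> ?k * (\<bar>f x - f y\<bar> * p ?t y x)"
              using r by (simp add: powr_powr powr_minus mult_ac divide_inverse)
            then show ?thesis
              using True pos by (simp add: ennreal_mult'[symmetric] ennreal_leI)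
          qed simp
        qed
      qed
    qed
  qed
  also have "\<dots> = (\<integral>\<^sup>+y. ennreal ?k * (\<integral>\<^sup>+x. ennreal (\<bar>f x - f y\<bar> * p ?t y x) \<partial>M) \<partial>M)"
    using t by (intro nn_integral_cong nn_integral_cmult) measurable
  also have "\<dots> = ennreal ?k * heat_variation M p ?t f"
    unfolding heat_variation_def using t by (intro nn_integral_cmult) measurable
  finally show ?thesis .
qed

text \<open>Beyond a large multiple \<open>L\<close> of the natural length scale the exponential factor in
  \<open>kernel_comparison\<close> is as small as desired. The bound
  \<open>2\<^sup>-\<^sup>j\<^sup>-\<^sup>1\<close> makes the far part at most half of the heat
  variation, as changing the time by the factor \<open>2\<^sup>j\<close> costs at most
  \<open>2\<^sup>j\<close>.\<close>

lemma heat_variation_near_far: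
  obtains L K and j :: nat where "0 < L" "0 < K"
    "\<And>t. 0 < t \<Longrightarrow> AE y in M. AE x in M. p t y x
       \<le> K / measure M (ball y (L * t powr (1 / dW))) * indicator (ball y (L * t powr (1 / dW))) x
         + p (2 ^ j * t) y x / 2 ^ Suc j"
proof -
  obtain j :: nat and A0 where A0: "0 < A0" and comp: "\<And>t. 0 < t \<Longrightarrow>
       AE y in M. AE x in M. p t y x \<le> A0 * exp (- (c4 / 2) * scaled_dist t y x) * p (2 ^ j * t) y x"
    by (rule kernel_comparison, rule that)
  define \<theta> where "\<theta> = ln (2 ^ Suc j * A0) / (c4 / 2)"
  \<comment> \<open>\<open>L \<ge> 1\<close> so that raising \<open>L\<close> to the exponent \<open>dW / (dW - 1) \<ge> 1\<close> does not make it smaller.\<close>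
  define L where "L = max 1 \<theta>"
  define D where "D = exp (c2 * L powr (dW / (dW - 1))) / c1"
  have L: "1 \<le> L" "\<theta> \<le> L" by (auto simp: L_def)
  have D: "0 < D" using pos by (simp add: D_def)
  show thesis
  proof (rule that[of L "c3 * D" j])
    show "0 < L" "0 < c3 * D" using L D pos by auto
    fix t :: real assume t: "0 < t"
    have L0: "0 \<le> L" using L by simp
    let ?r = "L * t powr (1 / dW)"
    show "AE y in M. AE x in M. p t y x
       \<le> c3 * D / measure M (ball y ?r) * indicator (ball y ?r) x + p (2 ^ j * t) y x / 2 ^ Suc j"
      using kernel_bounds kernel_pos comp[OF t] doubling[OF t L0]
    proof eventually_elim
      case (elim y)
      have V: "0 < measure M (ball y ?r)" "0 < measure M (ball y (t powr (1 / dW)))"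
        using L t by (auto intro!: measure_ball_pos)
      have W: "measure M (ball y ?r) \<le> D * measure M (ball y (t powr (1 / dW)))"
        using elim(4) by (simp add: D_def)
      show ?case using elim(1-3)
      proof eventually_elim
        case (elim x)
        have pp: "0 < p (2 ^ j * t) y x" using elim(2) t by simp
        show ?case
        proof (cases "x \<in> ball y ?r")
          case True
          have "p t y x \<le> c3 / measure M (ball y (t powr (1 / dW))) * 1"
          proof -
            have "p t y x \<le> c3 / measure M (ball y (t powr (1 / dW)))
                * exp (- c4 * (dist y x powr dW / t) powr (1 / (dW - 1)))"
              using elim(1)[rule_format, OF t] by simp
            also have "\<dots> \<le> c3 / measure M (ball y (t powr (1 / dW))) * 1"
              using pos V by (intro mult_left_mono) auto
            finally show ?thesis .
          qed
          also have "\<dots> \<le> c3 * D / measure M (ball y ?r)"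
            using W V D pos by (simp add: field_simps)
          also have "\<dots> \<le> c3 * D / measure M (ball y ?r) * indicator (ball y ?r) x
              + p (2 ^ j * t) y x / 2 ^ Suc j"
            using True pp by simp
          finally show ?thesis .
        next
          case False
          have "L powr 1 \<le> L powr (dW / (dW - 1))"
            using L dW by (intro powr_mono) auto
          also have "\<dots> = (?r powr dW / t) powr (1 / (dW - 1))"
            using L t dW by (simp add: powr_mult powr_powr)
          also have "\<dots> \<le> scaled_dist t y x"
            unfolding scaled_dist_def using False t dW L
            by (intro powr_mono2 divide_right_mono) auto
          finally have "\<theta> \<le> scaled_dist t y x" using L by simp
          then have "ln (2 ^ Suc j * A0) \<le> c4 / 2 * scaled_dist t y x"
            using pos by (simp add: \<theta>_def field_simps)
          then have "exp (ln (2 ^ Suc j * A0)) \<le> exp (c4 / 2 * scaled_dist t y x)"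
            by (simp only: exp_le_cancel_iff)
          then have "A0 * exp (- (c4 / 2) * scaled_dist t y x) \<le> 1 / 2 ^ Suc j"
            using A0 by (simp add: exp_minus field_simps)
          then have "A0 * exp (- (c4 / 2) * scaled_dist t y x) * p (2 ^ j * t) y x
              \<le> 1 / 2 ^ Suc j * p (2 ^ j * t) y x"
            using pp by (intro mult_right_mono) auto
          then show ?thesis using elim(3) False by simp
        qed
      qed
    qed
  qed
qed

text \<open>Integrating \<open>heat_variation_near_far\<close> bounds the heat variation \<open>v\<close> by a
  multiple of the average over balls plus \<open>v/2\<close>. The term \<open>v/2\<close> can be
  subtracted since \<open>v\<close> is finite.\<close>

lemma heat_variation_le_ball_variation:
  obtains L K where "0 < L" "0 < K"
    "\<And>t f. 0 < t \<Longrightarrow> integrable M f \<Longrightarrow> heat_variation M p t f < \<infinity> \<Longrightarrow>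
       heat_variation M p t f
         \<le> ennreal (K * (L * t powr (1 / dW)) powr (\<alpha> * dW)) * ball_variation M dW \<alpha> (L * t powr (1 / dW)) f"
proof -
  obtain L K and j :: nat where L: "0 < L" and K: "0 < K" and split:
    "\<And>t. 0 < t \<Longrightarrow> AE y in M. AE x in M. p t y x
       \<le> K / measure M (ball y (L * t powr (1 / dW))) * indicator (ball y (L * t powr (1 / dW))) x
         + p (2 ^ j * t) y x / 2 ^ Suc j"
    by (rule heat_variation_near_far, rule that)
  show thesis
  proof (rule that[of L "2 * K"])
    show "0 < L" "0 < 2 * K" using L K by auto
    fix t f assume t: "0 < t" and f: "integrable M f" and fin: "heat_variation M p t f < \<infinity>"
    have [measurable]: "f \<in> borel_measurable M" using f by auto
    define r where "r = L * t powr (1 / dW)"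
    have r: "0 < r" using L t by (simp add: r_def)
    let ?s = "2 ^ j * t" and ?k = "K * r powr (\<alpha> * dW)" and ?e = "1 / 2 ^ Suc j :: real"
    have s: "0 < ?s" using t by simp
    define g where "g y x = ennreal (\<bar>f x - f y\<bar> / (r powr (\<alpha> * dW) * measure M (ball y r))) * indicator (ball y r) x" for y x
    define h where "h y x = ennreal (\<bar>f x - f y\<bar> * p ?s y x)" for y x
    have ind: "indicator (ball y r) x = (if dist y x < r then 1 else 0 :: ennreal)" for x y
      by (auto simp: indicator_def)
    have gm: "case_prod g \<in> borel_measurable (M \<Otimes>\<^sub>M M)"
      unfolding g_def[abs_def] ind by measurable
    have hm: "case_prod h \<in> borel_measurable (M \<Otimes>\<^sub>M M)"
      unfolding h_def[abs_def] using s by measurable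
    have lin: "ennreal (a * b + c * d) = ennreal a * ennreal b + ennreal c * ennreal d"
      if "0 \<le> a" "0 \<le> b" "0 \<le> c" "0 \<le> d" for a b c d
      using that by (simp add: ennreal_mult)
    note meas = measurable_compose[OF measurable_Pair1' gm] measurable_compose[OF measurable_Pair1' hm]
    have gm1: "g y \<in> borel_measurable M" and hm1: "h y \<in> borel_measurable M" for y
      using meas[of y] by simp_all
    have gm2: "(\<lambda>y. integral\<^sup>N M (g y)) \<in> borel_measurable M"
      and hm2: "(\<lambda>y. integral\<^sup>N M (h y)) \<in> borel_measurable M"
      using borel_measurable_nn_integral[OF gm] borel_measurable_nn_integral[OF hm] by simp_all
    have "heat_variation M p t f \<le> (\<integral>\<^sup>+y. (\<integral>\<^sup>+x. ennreal ?k * g y x + ennreal ?e * h y x \<partial>M) \<partial>M)"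
      unfolding heat_variation_def
    proof (rule nn_integral_mono_AE)
      show "AE y in M. (\<integral>\<^sup>+x. ennreal (\<bar>f x - f y\<bar> * p t y x) \<partial>M)
          \<le> (\<integral>\<^sup>+x. ennreal ?k * g y x + ennreal ?e * h y x \<partial>M)"
        using split[OF t] kernel_pos
      proof eventually_elim
        case (elim y)
        have V: "0 < measure M (ball y r)" using r by (rule measure_ball_pos)
        show ?case
        proof (rule nn_integral_mono_AE)
          show "AE x in M. ennreal (\<bar>f x - f y\<bar> * p t y x) \<le> ennreal ?k * g y x + ennreal ?e * h y x"
            using elim
          proof eventually_elim
            case (elim x)
            have pp: "0 < p ?s y x" using elim s by blast
            have "\<bar>f x - f y\<bar> * p t y x
                \<le> \<bar>f x - f y\<bar> * (K / measure M (ball y r) * indicator (ball y r) x + p ?s y x / 2 ^ Suc j)"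
              using elim(1) by (intro mult_left_mono) (auto simp: r_def)
            also have "\<dots> = ?k * (\<bar>f x - f y\<bar> / (r powr (\<alpha> * dW) * measure M (ball y r)) * indicator (ball y r) x)
                + ?e * (\<bar>f x - f y\<bar> * p ?s y x)"
              using r by (simp add: field_simps)
            finally have "ennreal (\<bar>f x - f y\<bar> * p t y x)
                \<le> ennreal (?k * (\<bar>f x - f y\<bar> / (r powr (\<alpha> * dW) * measure M (ball y r)) * indicator (ball y r) x)
                + ?e * (\<bar>f x - f y\<bar> * p ?s y x))" by (rule ennreal_leI)
            also have "\<dots> = ennreal ?k * ennreal (\<bar>f x - f y\<bar> / (r powr (\<alpha> * dW) * measure M (ball y r)) * indicator (ball y r) x)
                + ennreal ?e * ennreal (\<bar>f x - f y\<bar> * p ?s y x)"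
              by (rule lin) (use K V pp in auto)
            also have "\<dots> = ennreal ?k * g y x + ennreal ?e * h y x"
              by (simp add: g_def h_def indicator_def)
            finally show ?case .
          qed
        qed
      qed
    qed
    also have "\<dots> = (\<integral>\<^sup>+y. ennreal ?k * integral\<^sup>N M (g y) + ennreal ?e * integral\<^sup>N M (h y) \<partial>M)"
      using gm1 hm1 by (intro nn_integral_cong) (simp add: nn_integral_add nn_integral_cmult)
    also have "\<dots> = ennreal ?k * (\<integral>\<^sup>+y. integral\<^sup>N M (g y) \<partial>M) + ennreal ?e * (\<integral>\<^sup>+y. integral\<^sup>N M (h y) \<partial>M)"
      using gm2 hm2 by (simp add: nn_integral_add nn_integral_cmult)
    also have "(\<integral>\<^sup>+y. integral\<^sup>N M (h y) \<partial>M) = heat_variation M p ?s f"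
      by (simp add: heat_variation_def h_def[abs_def])
    also have "(\<integral>\<^sup>+y. integral\<^sup>N M (g y) \<partial>M) = ball_variation M dW \<alpha> r f"
      by (simp add: ball_variation_def g_def[abs_def])
    finally have le: "heat_variation M p t f
        \<le> ennreal ?k * ball_variation M dW \<alpha> r f + ennreal ?e * heat_variation M p ?s f" .
    have "ennreal ?e * heat_variation M p ?s f \<le> ennreal ?e * (2 ^ j * heat_variation M p t f)"
      by (intro mult_left_mono heat_variation_power2 t f) simp
    also have "\<dots> = ennreal (1 / 2) * heat_variation M p t f"
    proof -
      have "(2 :: ennreal) ^ j = ennreal (2 ^ j)"
        by (metis ennreal_numeral ennreal_power zero_le_numeral)
      then have "ennreal ?e * 2 ^ j = ennreal (?e * 2 ^ j)"
        by (simp only: ennreal_mult[symmetric] zero_le_power zero_le_numeral zero_le_divide_1_iff)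
      also have "?e * 2 ^ j = 1 / 2" by simp
      finally show ?thesis by (simp only: mult.assoc[symmetric])
    qed
    finally have le': "heat_variation M p t f
        \<le> ennreal ?k * ball_variation M dW \<alpha> r f + ennreal (1 / 2) * heat_variation M p t f"
      using le by (meson add_left_mono order_trans)
    obtain v where v: "0 \<le> v" "heat_variation M p t f = ennreal v"
      using fin by (cases "heat_variation M p t f") auto
    show "heat_variation M p t f
         \<le> ennreal (2 * K * (L * t powr (1 / dW)) powr (\<alpha> * dW)) * ball_variation M dW \<alpha> (L * t powr (1 / dW)) f"
    proof (cases "ball_variation M dW \<alpha> r f")
      case (real b)
      have "ennreal v \<le> ennreal (?k * b + 1 / 2 * v)"
        using le' lin[of ?k b "1 / 2" v] v(1) K real(1) unfolding v(2) real(2) by simp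
      then have "v \<le> ?k * b + 1 / 2 * v"
        using v real K by (subst (asm) ennreal_le_iff) auto
      then have "ennreal v \<le> ennreal (2 * ?k * b)" by (intro ennreal_leI) simp
      also have "\<dots> = ennreal (2 * ?k) * ennreal b" using real K by (intro ennreal_mult) auto
      finally show ?thesis using v real by (simp add: r_def mult.assoc)
    next
      case top
      then show ?thesis using r K by (simp add: r_def[symmetric] ennreal_mult_top)
    qed
  qed
qed

section \<open>Distance to the heat flow\<close>

text \<open>By conservativeness \<open>P\<^sub>t f (y) - f y\<close> is the integral of
  \<open>p\<^sub>t(y,x) (f x - f y)\<close>. Where this is not absolutely convergent, the inner
  integral of the heat variation at \<open>y\<close> is infinite.\<close>

lemma heat_op_diff_le_heat_variation:
  assumes t: "0 < t" and [measurable]: "f \<in> borel_measurable M"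
  shows "(\<integral>\<^sup>+x. ennreal \<bar>heat_op M p t f x - f x\<bar> \<partial>M) \<le> heat_variation M p t f"
  unfolding heat_variation_def
proof (rule nn_integral_mono_AE)
  show "AE y in M. ennreal \<bar>heat_op M p t f y - f y\<bar> \<le> (\<integral>\<^sup>+x. ennreal (\<bar>f x - f y\<bar> * p t y x) \<partial>M)"
    using kernel_mass[OF t] kernel_pos
  proof eventually_elim
    case (elim y)
    have [measurable]: "p t y \<in> borel_measurable M" using elim(1) by auto
    have eq: "AE x in M. ennreal (\<bar>f x - f y\<bar> * p t y x) = ennreal (norm (p t y x * (f x - f y)))"
      using elim(2) by eventually_elim (use t in \<open>auto simp: abs_mult mult.commute less_imp_le\<close>)
    have nn: "(\<integral>\<^sup>+x. ennreal (\<bar>f x - f y\<bar> * p t y x) \<partial>M) = (\<integral>\<^sup>+x. ennreal (norm (p t y x * (f x - f y))) \<partial>M)"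
      by (rule nn_integral_cong_AE[OF eq])
    show ?case
    proof (cases "(\<integral>\<^sup>+x. ennreal (norm (p t y x * (f x - f y))) \<partial>M) < \<infinity>")
      case True
      then have i: "integrable M (\<lambda>x. p t y x * (f x - f y))" by (intro integrableI_bounded) auto
      have j: "integrable M (\<lambda>x. p t y x * f y)" using elim(1) by simp
      have "heat_op M p t f y = (\<integral>x. p t y x * (f x - f y) + p t y x * f y \<partial>M)"
        by (simp add: heat_op_def algebra_simps)
      also have "\<dots> = (\<integral>x. p t y x * (f x - f y) \<partial>M) + f y"
        using i j elim(1) by simp
      finally have "\<bar>heat_op M p t f y - f y\<bar> = norm (\<integral>x. p t y x * (f x - f y) \<partial>M)" by simp
      then show ?thesis unfolding nn using integral_norm_bound_ennreal[OF i] by simp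
    next
      case False
      then show ?thesis unfolding nn by (simp only: infinity_ennreal_def not_less top_unique top_greatest)
    qed
  qed
qed


section \<open>Chain of inequalities between the semi-norms\<close>

text \<open>The form of \<open>heat_loss_le_smaller_time\<close> for functions and normalized heat variations.
  The constant factor between the times is moved into the range of \<open>s\<close>, so that
  \<open>s\<close> can tend to zero freely.\<close>

lemma heat_variation_le_smaller_time:
  assumes \<alpha>: "0 < \<alpha>" "\<alpha> \<le> 1" and C: "0 < C"
    and holder: "\<And>t f x y. 0 < t \<Longrightarrow> ereal t < R \<Longrightarrow> f \<in> Linfty M \<Longrightarrow>
           \<bar>heat_op M p t f x - heat_op M p t f y\<bar>
             \<le> C * (dist x y powr (dW * (1 - \<alpha>)) / t powr (1 - \<alpha>)) * linfty_norm M f"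
  obtains m K :: real where "0 < m" "0 < K"
    "\<And>s t f. 0 < s \<Longrightarrow> s \<le> m * t \<Longrightarrow> ereal t < R \<Longrightarrow> integrable M f \<Longrightarrow>
       ennreal (t powr (- \<alpha>)) * heat_variation M p t f
         \<le> ennreal K * (ennreal (s powr (- \<alpha>)) * heat_variation M p s f)"
proof -
  obtain j :: nat and K where K: "0 < K" and loss:
    "\<And>s t A. 0 < s \<Longrightarrow> s \<le> t \<Longrightarrow> ereal t < R \<Longrightarrow> A \<in> sets M \<Longrightarrow> emeasure M A < \<infinity> \<Longrightarrow>
       heat_loss t A \<le> K * (t / s) powr \<alpha> * heat_loss (2 ^ j * s) A"
    by (rule heat_loss_le_smaller_time[OF \<alpha> C holder], assumption+, rule that)
  define m :: real where "m = 2 ^ j"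
  have m: "0 < m" by (simp add: m_def)
  show thesis
  proof (rule that[of m "K * m powr \<alpha>"])
    show "0 < m" "0 < K * m powr \<alpha>" using m K by auto
    fix s t :: real and f :: "'a \<Rightarrow> real"
    assume s: "0 < s" "s \<le> m * t" and t: "ereal t < R" and f: "integrable M f"
    let ?k = "K * (t / (s / m)) powr \<alpha>"
    have t0: "0 < t" using s m by (smt (verit) mult_nonneg_nonpos)
    have sm: "0 < s / m" "s / m \<le> t" "2 ^ j * (s / m) = s"
      using s m by (auto simp: field_simps m_def)
    have "heat_variation M p t f \<le> ennreal ?k * heat_variation M p s f"
    proof (rule heat_variation_transfer[OF t0 s(1) f])
      fix A assume A: "A \<in> sets M" "emeasure M A < \<infinity>"
      have "heat_loss t A \<le> ?k * heat_loss s A"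
        using loss[OF sm(1,2) t A] sm by simp
      then have "ennreal (heat_loss t A) \<le> ennreal ?k * ennreal (heat_loss s A)"
        using heat_loss_eq_flow(1)[OF s(1) A] K by (simp add: ennreal_mult[symmetric] ennreal_leI)
      then have "2 * ennreal (heat_loss t A) \<le> 2 * (ennreal ?k * ennreal (heat_loss s A))"
        by (rule mult_left_mono) simp
      then show "heat_variation M p t (indicat_real A) \<le> ennreal ?k * heat_variation M p s (indicat_real A)"
        using heat_variation_indicator[OF A(1) t0 A(2)] heat_variation_indicator[OF A(1) s(1) A(2)]
        by (simp add: mult_ac)
    qed
    then have "ennreal (t powr (- \<alpha>)) * heat_variation M p t f
        \<le> ennreal (t powr (- \<alpha>)) * (ennreal ?k * heat_variation M p s f)"
      by (rule mult_left_mono) simp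
    also have "\<dots> = ennreal (t powr (- \<alpha>) * ?k) * heat_variation M p s f"
      using K by (simp add: ennreal_mult mult.assoc)
    also have "t powr (- \<alpha>) * ?k = K * m powr \<alpha> * s powr (- \<alpha>)"
      using t0 s m by (simp add: powr_divide powr_mult powr_minus field_simps)
    finally show "ennreal (t powr (- \<alpha>)) * heat_variation M p t f
        \<le> ennreal (K * m powr \<alpha>) * (ennreal (s powr (- \<alpha>)) * heat_variation M p s f)"
      using K by (simp add: ennreal_mult mult.assoc)
  qed
qed

text \<open>Reaches times outside the range \<open>(0, R)\<close> of the Besov semi-norm.\<close>

lemma normalized_heat_variation_scale:
  assumes t: "0 < t" and f: "integrable M f" and \<alpha>: "0 < \<alpha>"
  shows "ennreal (t powr (- \<alpha>)) * heat_variation M p t f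
    \<le> 2 ^ n * (ennreal ((t / 2 ^ n) powr (- \<alpha>)) * heat_variation M p (t / 2 ^ n) f)"
proof -
  have "t powr (- \<alpha>) \<le> (t / 2 ^ n) powr (- \<alpha>)"
    using t \<alpha> by (intro powr_mono2') (auto simp: field_simps)
  moreover have "heat_variation M p t f \<le> 2 ^ n * heat_variation M p (t / 2 ^ n) f"
    using heat_variation_power2[of "t / 2 ^ n" f n] t f by simp
  ultimately have "ennreal (t powr (- \<alpha>)) * heat_variation M p t f
      \<le> ennreal ((t / 2 ^ n) powr (- \<alpha>)) * (2 ^ n * heat_variation M p (t / 2 ^ n) f)"
    by (intro mult_mono ennreal_leI) auto
  then show ?thesis by (simp add: mult_ac)
qed


text \<open>Every small radius has the form \<open>r = L * s powr (1 / dW)\<close> for some time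
  \<open>s\<close>, at which the heat variation is controlled by the average over balls of radius
  \<open>r\<close> and controls the heat variation at all later times below \<open>R\<close>.\<close>

lemma besov_seminorm_le_Liminf_ball_variation:
  assumes m: "0 < m" and K: "0 < K"
    and le: "\<And>s t f. 0 < s \<Longrightarrow> s \<le> m * t \<Longrightarrow> ereal t < R \<Longrightarrow> integrable M f \<Longrightarrow>
       ennreal (t powr (- \<alpha>)) * heat_variation M p t f
         \<le> ennreal K * (ennreal (s powr (- \<alpha>)) * heat_variation M p s f)"
  obtains K' where "0 < K'"
    "\<And>f. f \<in> BV M p \<alpha> \<Longrightarrow> besov_seminorm M p \<alpha> R f
       \<le> ennreal K' * Liminf (at_right 0) (\<lambda>r. ball_variation M dW \<alpha> r f)"
proof -
  obtain L K3 where L: "0 < L" and K3: "0 < K3" and ball: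
    "\<And>t f. 0 < t \<Longrightarrow> integrable M f \<Longrightarrow> heat_variation M p t f < \<infinity> \<Longrightarrow>
       heat_variation M p t f
         \<le> ennreal (K3 * (L * t powr (1 / dW)) powr (\<alpha> * dW)) * ball_variation M dW \<alpha> (L * t powr (1 / dW)) f"
    by (rule heat_variation_le_ball_variation[where \<alpha>=\<alpha>], rule that)
  define K' where "K' = K * (K3 * L powr (\<alpha> * dW))"
  have K': "0 < K'" using K K3 L by (simp add: K'_def)
  show thesis
  proof (rule that[OF K'])
    fix f assume f: "f \<in> BV M p \<alpha>"
    then have fi: "integrable M f" by (simp add: BV_def besov_def)
    show "besov_seminorm M p \<alpha> R f
       \<le> ennreal K' * Liminf (at_right 0) (\<lambda>r. ball_variation M dW \<alpha> r f)"
      unfolding besov_seminorm_def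
    proof (rule SUP_least)
      fix t assume "t \<in> {t. 0 < t \<and> ereal t < R}"
      then have t: "0 < t" "ereal t < R" by auto
      show "ennreal (t powr (- \<alpha>)) * heat_variation M p t f
        \<le> ennreal K' * Liminf (at_right 0) (\<lambda>r. ball_variation M dW \<alpha> r f)"
      proof (rule le_Liminf_at_right[OF K'])
        show "0 < L * (m * t) powr (1 / dW)" using L m t by simp
        fix r assume r: "0 < r" "r < L * (m * t) powr (1 / dW)"
        define s where "s = (r / L) powr dW"
        have s: "0 < s" using r L by (simp add: s_def)
        have sr: "L * s powr (1 / dW) = r" using r L dW by (simp add: s_def powr_powr)
        have "(r / L) powr dW \<le> ((m * t) powr (1 / dW)) powr dW"
          using r L dW by (intro powr_mono2) (auto simp: field_simps)
        also have "\<dots> = m * t" using m t dW by (simp add: powr_powr)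
        finally have smt: "s \<le> m * t" by (simp add: s_def)
        have rs: "r powr (\<alpha> * dW) = L powr (\<alpha> * dW) * s powr \<alpha>"
          using s L dW by (simp add: sr[symmetric] powr_mult powr_powr)
        have fin: "heat_variation M p s f < \<infinity>"
          using f s by (intro heat_variation_finite[of f \<alpha>]) (simp_all add: BV_def)
        have "ennreal (t powr (- \<alpha>)) * heat_variation M p t f
            \<le> ennreal K * (ennreal (s powr (- \<alpha>)) * heat_variation M p s f)"
          by (intro le s smt t fi)
        also have "\<dots> \<le> ennreal K * (ennreal (s powr (- \<alpha>))
            * (ennreal (K3 * r powr (\<alpha> * dW)) * ball_variation M dW \<alpha> r f))"
          using ball[OF s fi fin] by (intro mult_left_mono) (auto simp: sr)
        also have "\<dots> = ennreal (K * (s powr (- \<alpha>) * (K3 * r powr (\<alpha> * dW)))) * ball_variation M dW \<alpha> r f"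
          using K K3 by (simp add: ennreal_mult mult.assoc)
        also have "K * (s powr (- \<alpha>) * (K3 * r powr (\<alpha> * dW))) = K'"
          using s by (simp add: K'_def rs powr_minus field_simps)
        finally show "ennreal (t powr (- \<alpha>)) * heat_variation M p t f
            \<le> ennreal K' * ball_variation M dW \<alpha> r f" .
      qed
    qed
  qed
qed

text \<open>A radius \<open>r < R\<close> corresponds to the time \<open>r powr dW\<close>, which may exceed
  \<open>R\<close> when \<open>R\<close> is finite. Then a fixed number \<open>n\<close> of halvings
  brings all these times below \<open>R\<close>.\<close>

lemma SUP_ball_variation_le_besov_seminorm:
  fixes R :: ereal
  assumes R: "0 < R" and \<alpha>: "0 < \<alpha>"
  obtains K where "0 < K"
    "\<And>f. integrable M f \<Longrightarrow> (SUP r\<in>{r. 0 < r \<and> ereal r < R}. ball_variation M dW \<alpha> r f)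
       \<le> ennreal K * besov_seminorm M p \<alpha> R f"
proof -
  have "\<exists>n. \<forall>r. 0 < r \<longrightarrow> ereal r < R \<longrightarrow> ereal (r powr dW / 2 ^ n) < R"
  proof (cases R)
    case (real \<rho>)
    have \<rho>: "0 < \<rho>" using R real by simp
    then have "0 < \<rho> powr dW" by simp
    then obtain N where N: "\<And>n. N \<le> n \<Longrightarrow> \<rho> powr dW / 2 ^ n < \<rho>"
      by (rule halving_below[OF _ \<rho>]) blast
    have "r powr dW / 2 ^ N < \<rho>" if "0 < r" "r < \<rho>" for r
    proof -
      have "r powr dW / 2 ^ N \<le> \<rho> powr dW / 2 ^ N"
        using that dW by (intro divide_right_mono powr_mono2) auto
      then show ?thesis using N[of N] by simp
    qed
    then show ?thesis using real by (intro exI[of _ N]) auto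
  qed (use R in auto)
  then obtain n where n: "\<And>r. 0 < r \<Longrightarrow> ereal r < R \<Longrightarrow> ereal (r powr dW / 2 ^ n) < R" by blast
  show thesis
  proof (rule that[of "exp c2 / c1 * 2 ^ n"])
    show "0 < exp c2 / c1 * 2 ^ n" using pos by simp
    fix f :: "'a \<Rightarrow> real" assume f: "integrable M f"
    show "(SUP r\<in>{r. 0 < r \<and> ereal r < R}. ball_variation M dW \<alpha> r f)
       \<le> ennreal (exp c2 / c1 * 2 ^ n) * besov_seminorm M p \<alpha> R f"
    proof (rule SUP_least)
      fix r assume "r \<in> {r. 0 < r \<and> ereal r < R}"
      then have r: "0 < r" "ereal r < R" by auto
      let ?t = "r powr dW"
      have t: "0 < ?t" using r by simp
      have "ball_variation M dW \<alpha> r f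
          \<le> ennreal (exp c2 / c1) * (ennreal (?t powr (- \<alpha>)) * heat_variation M p ?t f)"
      proof -
        have "ennreal (exp c2 / c1 * ?t powr (- \<alpha>)) = ennreal (exp c2 / c1) * ennreal (?t powr (- \<alpha>))"
          using pos by (intro ennreal_mult) auto
        with ball_variation_le_heat_variation[of f r \<alpha>] f r show ?thesis
          by (auto simp only: mult.assoc borel_measurable_integrable)
      qed
      also have "\<dots> \<le> ennreal (exp c2 / c1)
          * (2 ^ n * (ennreal ((?t / 2 ^ n) powr (- \<alpha>)) * heat_variation M p (?t / 2 ^ n) f))"
        by (intro mult_left_mono normalized_heat_variation_scale t f \<alpha>) simp
      also have "\<dots> \<le> ennreal (exp c2 / c1) * (2 ^ n * besov_seminorm M p \<alpha> R f)"
        unfolding besov_seminorm_def using n[OF r] t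
        by (intro mult_left_mono SUP_upper2[of "?t / 2 ^ n"]) auto
      also have "\<dots> = ennreal (exp c2 / c1 * 2 ^ n) * besov_seminorm M p \<alpha> R f"
      proof -
        have "(2 :: ennreal) ^ n = ennreal (2 ^ n)"
          by (metis ennreal_numeral ennreal_power zero_le_numeral)
        then have "ennreal (exp c2 / c1 * 2 ^ n) = ennreal (exp c2 / c1) * 2 ^ n"
          using pos by (subst ennreal_mult) auto
        then show ?thesis by (simp only: mult.assoc)
      qed
      finally show "ball_variation M dW \<alpha> r f
          \<le> ennreal (exp c2 / c1 * 2 ^ n) * besov_seminorm M p \<alpha> R f" .
    qed
  qed
qed

end

theorem theorem3p6:
  fixes M :: "('a::metric_space) measure"
    and E :: "('a \<Rightarrow> real) \<Rightarrow> ('a \<Rightarrow> real) \<Rightarrow> real"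
    and F :: "('a \<Rightarrow> real) set"
    and P :: "real \<Rightarrow> ('a \<Rightarrow> real) \<Rightarrow> ('a \<Rightarrow> real)"
    and p :: "real \<Rightarrow> 'a \<Rightarrow> 'a \<Rightarrow> real"
    and c1 c2 c3 c4 dW \<alpha>1 C :: real
    and R :: ereal
  assumes "strongly_local_metric_dirichlet_space M E F"
    and "\<And>(x::'a) r. compact (closure (ball x r))"
    and "heat_semigroup M E F P"
    and "continuous_heat_kernel M P p"
    and "conservative M p"
    and "c1 > 0" and "c2 > 0" and "c3 > 0" and "c4 > 0" and "dW \<ge> 2"
    and "sub_gaussian_estimates M p dW c1 c2 c3 c4"
    and "ereal \<alpha>1 = critical_exponent M p" and "\<alpha>1 > 0"
    and "R > 0"
    and "C > 0"
    and "\<And>t f x y. 0 < t \<Longrightarrow> ereal t < R \<Longrightarrow> f \<in> Linfty M \<Longrightarrow>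
           \<bar>heat_op M p t f x - heat_op M p t f y\<bar>
             \<le> C * (dist x y powr (dW * (1 - \<alpha>1)) / t powr (1 - \<alpha>1)) * linfty_norm M f"
  shows "PPI1 M p \<alpha>1 R \<and>
    seminorm_equiv (BV M p \<alpha>1)
      (heat_Var M p \<alpha>1)
      (\<lambda>f. Liminf (at_right 0) (\<lambda>r. ball_variation M dW \<alpha>1 r f)) \<and>
    seminorm_equiv (BV M p \<alpha>1)
      (\<lambda>f. Liminf (at_right 0) (\<lambda>r. ball_variation M dW \<alpha>1 r f))
      (\<lambda>f. SUP r\<in>{r. 0 < r \<and> ereal r < R}. ball_variation M dW \<alpha>1 r f) \<and>
    seminorm_equiv (BV M p \<alpha>1)
      (\<lambda>f. SUP r\<in>{r. 0 < r \<and> ereal r < R}. ball_variation M dW \<alpha>1 r f)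
      (besov_seminorm M p \<alpha>1 R)"
proof -
  interpret heat_kernel_space M E F P p c1 c2 c3 c4 dW
    by (intro heat_kernel_space.intro assms)
  have "ereal \<alpha>1 \<le> ereal 1"
    using critical_exponent_le_1 unfolding assms(12)[symmetric] by (simp add: one_ereal_def)
  then have \<alpha>: "0 < \<alpha>1" "\<alpha>1 \<le> 1" using assms(13) by simp_all
  let ?V = "heat_Var M p \<alpha>1" and ?B = "besov_seminorm M p \<alpha>1 R"
    and ?L = "\<lambda>f. Liminf (at_right 0) (\<lambda>r. ball_variation M dW \<alpha>1 r f)"
    and ?S = "\<lambda>f. SUP r\<in>{r. 0 < r \<and> ereal r < R}. ball_variation M dW \<alpha>1 r f"
  obtain m K1 :: real where m: "0 < m" and K1: "0 < K1" and le:
    "\<And>s t f. 0 < s \<Longrightarrow> s \<le> m * t \<Longrightarrow> ereal t < R \<Longrightarrow> integrable M f \<Longrightarrow>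
       ennreal (t powr (- \<alpha>1)) * heat_variation M p t f
         \<le> ennreal K1 * (ennreal (s powr (- \<alpha>1)) * heat_variation M p s f)"
    by (rule heat_variation_le_smaller_time[OF \<alpha> assms(15,16)], assumption+, rule that)
  obtain K2 where K2: "0 < K2" and BL: "\<And>f. f \<in> BV M p \<alpha>1 \<Longrightarrow> ?B f \<le> ennreal K2 * ?L f"
    by (rule besov_seminorm_le_Liminf_ball_variation[OF m K1 le], assumption+, rule that)
  obtain K3 where K3: "0 < K3" and SB': "\<And>f. integrable M f \<Longrightarrow> ?S f \<le> ennreal K3 * ?B f"
    by (rule SUP_ball_variation_le_besov_seminorm[OF assms(14) \<alpha>(1)], rule that)
  have int: "integrable M f" if "f \<in> BV M p \<alpha>1" for f
    using that by (simp add: BV_def besov_def)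
  have SB: "?S f \<le> ennreal K3 * ?B f" if "f \<in> BV M p \<alpha>1" for f
    by (rule SB'[OF int[OF that]])
  have BV: "?B f \<le> ennreal K1 * ?V f" if f: "f \<in> BV M p \<alpha>1" for f
    unfolding besov_seminorm_def heat_Var_def
  proof (rule SUP_least)
    fix t assume "t \<in> {t. 0 < t \<and> ereal t < R}"
    then have t: "0 < t" "ereal t < R" by auto
    show "ennreal (t powr (- \<alpha>1)) * heat_variation M p t f
        \<le> ennreal K1 * Liminf (at_right 0) (\<lambda>t. ennreal (t powr (- \<alpha>1)) * heat_variation M p t f)"
      by (rule le_Liminf_at_right[OF K1, of "m * t"]) (use m t le int[OF f] in auto)
  qed
  have VB: "?V f \<le> ?B f" for f
    unfolding heat_Var_def besov_seminorm_def by (rule Liminf_at_right_le_SUP[OF assms(14)])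
  have LS: "?L f \<le> ?S f" for f
    by (rule Liminf_at_right_le_SUP[OF assms(14)])
  \<comment> \<open>Up to constants, \<open>?V \<le> ?B \<le> ?L \<le> ?S \<le> ?B \<le> ?V\<close>; each equivalence follows by composing these.\<close>
  have chain: "x \<le> ennreal (a * b) * z" if "x \<le> ennreal a * y" "y \<le> ennreal b * z" "0 < a" "0 < b"
    for x y z and a b :: real
    using order_trans[OF that(1) mult_left_mono[OF that(2)]] that(3,4)
    by (simp add: ennreal_mult mult.assoc)
  have "PPI1 M p \<alpha>1 R"
    unfolding PPI1_def
  proof (intro exI[of _ K1] conjI allI impI K1)
    fix t f assume t: "0 < t" "ereal t < R" and f: "f \<in> BV M p \<alpha>1"
    have "(\<integral>\<^sup>+ x. ennreal \<bar>heat_op M p t f x - f x\<bar> \<partial>M) \<le> heat_variation M p t f"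
      using int[OF f] by (intro heat_op_diff_le_heat_variation t) auto
    also have "\<dots> = ennreal (t powr \<alpha>1) * (ennreal (t powr (- \<alpha>1)) * heat_variation M p t f)"
      using t by (simp add: mult.assoc[symmetric] ennreal_mult[symmetric] powr_add[symmetric])
    also have "\<dots> \<le> ennreal (t powr \<alpha>1) * ?B f"
      unfolding besov_seminorm_def using t by (intro mult_left_mono SUP_upper) auto
    also have "\<dots> \<le> ennreal (t powr \<alpha>1) * (ennreal K1 * ?V f)"
      by (intro mult_left_mono BV f) simp
    also have "\<dots> = ennreal (K1 * t powr \<alpha>1) * ?V f"
      using K1 by (simp add: ennreal_mult mult_ac)
    finally show "(\<integral>\<^sup>+ x. ennreal \<bar>heat_op M p t f x - f x\<bar> \<partial>M)
        \<le> ennreal (K1 * t powr \<alpha>1) * ?V f" .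
  qed
  moreover have "seminorm_equiv (BV M p \<alpha>1) ?V ?L"
  proof (rule seminorm_equivI)
    show "0 < K2" "0 < K3 * K1" using K1 K2 K3 by auto
    fix f assume f: "f \<in> BV M p \<alpha>1"
    show "?V f \<le> ennreal K2 * ?L f" using VB BL[OF f] by (rule order_trans)
    show "?L f \<le> ennreal (K3 * K1) * ?V f"
      using LS chain[OF SB[OF f] BV[OF f] K3 K1] by (rule order_trans)
  qed
  moreover have "seminorm_equiv (BV M p \<alpha>1) ?L ?S"
  proof (rule seminorm_equivI)
    show "0 < (1::real)" "0 < K3 * K2" using K2 K3 by auto
    fix f assume f: "f \<in> BV M p \<alpha>1"
    show "?L f \<le> ennreal 1 * ?S f" using LS by simp
    show "?S f \<le> ennreal (K3 * K2) * ?L f" by (rule chain[OF SB[OF f] BL[OF f] K3 K2])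
  qed
  moreover have "seminorm_equiv (BV M p \<alpha>1) ?S ?B"
  proof (rule seminorm_equivI[OF K3 K2 SB])
    fix f assume f: "f \<in> BV M p \<alpha>1"
    show "?B f \<le> ennreal K2 * ?S f"
      using BL[OF f] mult_left_mono[OF LS] by (rule order_trans) simp
  qed
  ultimately show ?thesis by blast
qed

end
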